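(* If $G$ is a non-planar ribbon graph, then there are vertices $v, v'$ of $G$ such that the actions $\beta_v$ and $\beta_{v'}$ of $\operatorname{Pic}^0(G)$ on $S(G)$ are different.
   Context: A graph means a finite connected multigraph without loop edges; a ribbon graph is a graph with a cyclic ordering of the edges around each vertex. A ribbon graph is planar if it can be embedded in $\mathbb{R}^2$ without crossings so that the cyclic orderings are those induced by the counterclockwise orientation of the plane (equivalently, the closed orientable surface determined by the ribbon structure has genus $0$); otherwise it is non-planar. $S(G)$ is the set of spanning trees. Divisors are formal integer combinations of vertices. For $f : V(G) \to \mathbb{Z}$, $\Delta f = \sum_{u} \big(\sum_{\text{edges } uw} (f(u)-f(w))\big)(u)$; $D \sim D'$ if $D - D' = \Delta f$ for some $f$. $\operatorname{Pic}^d(G)$ is the set of linear equivalence classes of degree-$d$ divisors; $\operatorname{Pic}^0(G)$ is a group. The genus is $g = |E(G)|-|V(G)|+1$. For a spanning tree $T$ with non-tree edges $e_1,\dots,e_g$, a $T$-break divisor is $\sum_i (v_i)$ with $v_i$ an endpoint of $e_i$; $B(G)$ is the set of all such (over all $T$). Every class in $\operatorname{Pic}^g(G)$ contains exactly one element of $B(G)$, and $\operatorname{Pic}^0(G)$ acts on $B(G)$ by $\gamma \cdot D :=$ the unique break divisor linearly equivalent to $D + \gamma$. Bernardi map: for a vertex $v$, an edge $e$ incident to $v$, and a spanning tree $T$, the tour starts at $v$ and examines edges at $v$ in cyclic order starting with $e$; at a current vertex $u$, an examined edge $f \notin T$ is "cut through" from $u$ and the next edge at $u$ is examined, while an examined edge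 $f \in T$ is walked along to its other endpoint $u'$, after which the edges at $u'$ are examined in cyclic order starting with the edge after $f$. The tour ends when each tree edge has been traversed in both directions. For $f \notin T$, $\eta_{(v,e)}(f)$ is the endpoint from which $f$ is first cut through, and $\beta_{(v,e)}(T) = \sum_{f \notin T} (\eta_{(v,e)}(f))$; $\beta_{(v,e)} : S(G) \to B(G)$ is a bijection. The action $\beta_v$ is $\gamma \cdot T := \beta_{(v,e)}^{-1}(\gamma \cdot \beta_{(v,e)}(T))$ for any edge $e$ incident to $v$ (independent of $e$). *)

theory Defs
  imports Main
begin

section \<open>Multigraphs without loops\<close>

text \<open>A graph is given by a vertex set V, an edge set E and an endpoint map
  ends (each edge has two distinct endpoints, listed in an arbitrary order).\<close>

definition incident :: "('e \<Rightarrow> 'v \<times> 'v) \<Rightarrow> 'e \<Rightarrow> 'v \<Rightarrow> bool" where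
  "incident ends e v \<longleftrightarrow> fst (ends e) = v \<or> snd (ends e) = v"

definition other :: "('e \<Rightarrow> 'v \<times> 'v) \<Rightarrow> 'e \<Rightarrow> 'v \<Rightarrow> 'v" where
  "other ends e v = (if fst (ends e) = v then snd (ends e) else fst (ends e))"

definition edges_at :: "'e set \<Rightarrow> ('e \<Rightarrow> 'v \<times> 'v) \<Rightarrow> 'v \<Rightarrow> 'e set" where
  "edges_at E ends v = {e \<in> E. incident ends e v}"

definition adj_rel :: "'e set \<Rightarrow> ('e \<Rightarrow> 'v \<times> 'v) \<Rightarrow> ('v \<times> 'v) set" where
  "adj_rel E ends = {(u, w). \<exists>e\<in>E. ends e = (u, w) \<or> ends e = (w, u)}"

definition connected_on :: "'v set \<Rightarrow> 'e set \<Rightarrow> ('e \<Rightarrow> 'v \<times> 'v) \<Rightarrow> bool" where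
  "connected_on V E ends \<longleftrightarrow> (\<forall>u\<in>V. \<forall>w\<in>V. (u, w) \<in> (adj_rel E ends)\<^sup>*)"

definition graph :: "'v set \<Rightarrow> 'e set \<Rightarrow> ('e \<Rightarrow> 'v \<times> 'v) \<Rightarrow> bool" where
  "graph V E ends \<longleftrightarrow> finite V \<and> finite E \<and> V \<noteq> {} \<and>
     (\<forall>e\<in>E. fst (ends e) \<in> V \<and> snd (ends e) \<in> V \<and> fst (ends e) \<noteq> snd (ends e)) \<and>
     connected_on V E ends"

section \<open>Ribbon structure, faces, planarity\<close>

text \<open>rot v is the cyclic successor map on the edges at v (cyclic order).\<close>

definition ribbon_graph ::
  "'v set \<Rightarrow> 'e set \<Rightarrow> ('e \<Rightarrow> 'v \<times> 'v) \<Rightarrow> ('v \<Rightarrow> 'e \<Rightarrow> 'e) \<Rightarrow> bool" where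
  "ribbon_graph V E ends rot \<longleftrightarrow> graph V E ends \<and>
     (\<forall>v\<in>V. bij_betw (rot v) (edges_at E ends v) (edges_at E ends v) \<and>
        (\<forall>e\<in>edges_at E ends v. \<forall>e'\<in>edges_at E ends v. \<exists>n. (rot v ^^ n) e = e'))"

definition darts :: "'e set \<Rightarrow> ('e \<Rightarrow> 'v \<times> 'v) \<Rightarrow> ('v \<times> 'e) set" where
  "darts E ends = {(v, e). e \<in> E \<and> incident ends e v}"

text \<open>Face permutation: move along the edge to the other endpoint, then turn to
  the next edge in the cyclic order there.\<close>

definition face_perm :: "('e \<Rightarrow> 'v \<times> 'v) \<Rightarrow> ('v \<Rightarrow> 'e \<Rightarrow> 'e) \<Rightarrow> 'v \<times> 'e \<Rightarrow> 'v \<times> 'e" where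
  "face_perm ends rot d = (let w = other ends (snd d) (fst d) in (w, rot w (snd d)))"

definition num_faces :: "'e set \<Rightarrow> ('e \<Rightarrow> 'v \<times> 'v) \<Rightarrow> ('v \<Rightarrow> 'e \<Rightarrow> 'e) \<Rightarrow> nat" where
  "num_faces E ends rot = card (darts E ends //
     {(d, d'). d \<in> darts E ends \<and> d' \<in> darts E ends \<and> (\<exists>n. (face_perm ends rot ^^ n) d = d')})"

text \<open>Genus 0 of the associated closed orientable surface, i.e. V - E + F = 2
  (the edgeless one-vertex graph is the sphere with one face).\<close>

definition planar_ribbon ::
  "'v set \<Rightarrow> 'e set \<Rightarrow> ('e \<Rightarrow> 'v \<times> 'v) \<Rightarrow> ('v \<Rightarrow> 'e \<Rightarrow> 'e) \<Rightarrow> bool" where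
  "planar_ribbon V E ends rot \<longleftrightarrow>
     E = {} \<or> int (card V) - int (card E) + int (num_faces E ends rot) = 2"

section \<open>Spanning trees\<close>

definition spanning_tree :: "'v set \<Rightarrow> 'e set \<Rightarrow> ('e \<Rightarrow> 'v \<times> 'v) \<Rightarrow> 'e set \<Rightarrow> bool" where
  "spanning_tree V E ends T \<longleftrightarrow> T \<subseteq> E \<and> connected_on V T ends \<and> card T + 1 = card V"

definition spanning_trees :: "'v set \<Rightarrow> 'e set \<Rightarrow> ('e \<Rightarrow> 'v \<times> 'v) \<Rightarrow> 'e set set" where
  "spanning_trees V E ends = {T. spanning_tree V E ends T}"

section \<open>Divisors, linear equivalence, break divisors\<close>

text \<open>Divisors are functions 'v => int (vanishing outside V).\<close>

definition laplacian :: "'e set \<Rightarrow> ('e \<Rightarrow> 'v \<times> 'v) \<Rightarrow> ('v \<Rightarrow> int) \<Rightarrow> 'v \<Rightarrow> int" where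
  "laplacian E ends f u = (\<Sum>e\<in>edges_at E ends u. f u - f (other ends e u))"

definition lin_equiv ::
  "'v set \<Rightarrow> 'e set \<Rightarrow> ('e \<Rightarrow> 'v \<times> 'v) \<Rightarrow> ('v \<Rightarrow> int) \<Rightarrow> ('v \<Rightarrow> int) \<Rightarrow> bool" where
  "lin_equiv V E ends D D' \<longleftrightarrow>
     (\<exists>f. \<forall>u. D u - D' u = (if u \<in> V then laplacian E ends f u else 0))"

definition div0 :: "'v set \<Rightarrow> ('v \<Rightarrow> int) set" where
  "div0 V = {\<gamma>. (\<forall>w. w \<notin> V \<longrightarrow> \<gamma> w = 0) \<and> sum \<gamma> V = 0}"

definition break_divs :: "'v set \<Rightarrow> 'e set \<Rightarrow> ('e \<Rightarrow> 'v \<times> 'v) \<Rightarrow> ('v \<Rightarrow> int) set" where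
  "break_divs V E ends = {D. \<exists>T. spanning_tree V E ends T \<and>
      (\<exists>c. (\<forall>f\<in>E - T. incident ends f (c f)) \<and>
           D = (\<lambda>w. int (card {f \<in> E - T. c f = w})))}"

text \<open>The unique break divisor linearly equivalent to D.\<close>

definition break_rep ::
  "'v set \<Rightarrow> 'e set \<Rightarrow> ('e \<Rightarrow> 'v \<times> 'v) \<Rightarrow> ('v \<Rightarrow> int) \<Rightarrow> ('v \<Rightarrow> int)" where
  "break_rep V E ends D = (THE B. B \<in> break_divs V E ends \<and> lin_equiv V E ends B D)"

text \<open>Action of (a representative gamma of a class in) Pic^0 on break divisors.\<close>

definition pic_act_break ::
  "'v set \<Rightarrow> 'e set \<Rightarrow> ('e \<Rightarrow> 'v \<times> 'v) \<Rightarrow> ('v \<Rightarrow> int) \<Rightarrow> ('v \<Rightarrow> int) \<Rightarrow> ('v \<Rightarrow> int)" where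
  "pic_act_break V E ends \<gamma> D = break_rep V E ends (\<lambda>w. D w + \<gamma> w)"

section \<open>Bernardi map\<close>

text \<open>State of the tour: (current vertex u, edge f currently examined at u).\<close>

definition bernardi_step ::
  "('e \<Rightarrow> 'v \<times> 'v) \<Rightarrow> ('v \<Rightarrow> 'e \<Rightarrow> 'e) \<Rightarrow> 'e set \<Rightarrow> 'v \<times> 'e \<Rightarrow> 'v \<times> 'e" where
  "bernardi_step ends rot T s =
     (let u = fst s; f = snd s in
      if f \<in> T then (let u' = other ends f u in (u', rot u' f)) else (u, rot u f))"

definition tour ::
  "('e \<Rightarrow> 'v \<times> 'v) \<Rightarrow> ('v \<Rightarrow> 'e \<Rightarrow> 'e) \<Rightarrow> 'e set \<Rightarrow> 'v \<Rightarrow> 'e \<Rightarrow> nat \<Rightarrow> 'v \<times> 'e" where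
  "tour ends rot T v e n = (bernardi_step ends rot T ^^ n) (v, e)"

text \<open>For a non-tree edge f: the endpoint from which f is first cut through.\<close>

definition eta ::
  "('e \<Rightarrow> 'v \<times> 'v) \<Rightarrow> ('v \<Rightarrow> 'e \<Rightarrow> 'e) \<Rightarrow> 'e set \<Rightarrow> 'v \<Rightarrow> 'e \<Rightarrow> 'e \<Rightarrow> 'v" where
  "eta ends rot T v e f = fst (tour ends rot T v e (LEAST n. snd (tour ends rot T v e n) = f))"

definition bernardi ::
  "'e set \<Rightarrow> ('e \<Rightarrow> 'v \<times> 'v) \<Rightarrow> ('v \<Rightarrow> 'e \<Rightarrow> 'e) \<Rightarrow> 'v \<Rightarrow> 'e \<Rightarrow> 'e set \<Rightarrow> ('v \<Rightarrow> int)" where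
  "bernardi E ends rot v e T = (\<lambda>w. int (card {f \<in> E - T. eta ends rot T v e f = w}))"

text \<open>The action beta_v of Pic^0 on spanning trees (using some edge e at v).\<close>

definition tree_act ::
  "'v set \<Rightarrow> 'e set \<Rightarrow> ('e \<Rightarrow> 'v \<times> 'v) \<Rightarrow> ('v \<Rightarrow> 'e \<Rightarrow> 'e) \<Rightarrow> 'v \<Rightarrow> ('v \<Rightarrow> int) \<Rightarrow> 'e set \<Rightarrow> 'e set" where
  "tree_act V E ends rot v \<gamma> T =
     (let e = (SOME e. e \<in> edges_at E ends v);
          \<beta> = bernardi E ends rot v e
      in inv_into (spanning_trees V E ends) \<beta> (pic_act_break V E ends \<gamma> (\<beta> T)))"

end

(* Let sigma_F be the permutation of the darts given by the tour rule for an edge set F. Adding an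
   edge to F composes sigma_F with a transposition, hence merges two orbits or splits one; sigma_T
   is a single cycle for a spanning tree T, and sigma_E is the face permutation. So a non-planar
   ribbon graph has a spanning tree T and two edges e, f outside T that are interlaced, i.e. whose
   darts alternate along the tour of T; equivalently, sigma_(T+e+f) is again a single cycle.

   Suppose all the actions agree. Rotating the starting edge at v changes the class of the Bernardi
   divisor by an amount independent of the tree, so the difference of the Bernardi divisors for any
   two starting darts has a class independent of the tree. Take the starting darts just before and
   just after e = vv'. The difference is 0 for trees through e. For a tree T avoiding e it moves the
   chip of every edge interlaced with e from one side of the fundamental cycle of e to the other; as
   both divisors are break divisors, they are equal. Hence, at every vertex, interlaced edges leave
   the one side if and only if they leave the other, so that they have both ends on the fundamental
   cycle of e. By symmetry, interlaced edges e, f are parallel once they share a vertex, and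
   exchanging edges between T and {e, f} leads to the case where e is parallel to an edge g of T.
   Then all edges interlaced with e are parallel to e, and one of them lies strictly between e and g
   in the cyclic order at v; putting it into T in place of g decreases the distance from e to the
   tree edge indefinitely. *)

theory Submission
  imports Defs
begin

section \<open>Permutations of a finite set composed with a transposition\<close>

section \<open>Orbits of a permutation composed with a transposition\<close>

text \<open>Only forward iterates count; on a finite set periodicity makes the relation symmetric
  (\<open>same_orbit_sym\<close>).\<close>

definition same_orbit :: "('a \<Rightarrow> 'a) \<Rightarrow> 'a \<Rightarrow> 'a \<Rightarrow> bool" where
  "same_orbit p x y \<longleftrightarrow> (\<exists>n. (p ^^ n) x = y)"

lemma same_orbit_refl [simp]: "same_orbit p x x"
  unfolding same_orbit_def by (rule exI[of _ 0]) simp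

lemma same_orbit_step: "same_orbit p x (p x)"
  unfolding same_orbit_def by (rule exI[of _ 1]) simp

lemma same_orbit_trans:
  assumes "same_orbit p x y" "same_orbit p y z"
  shows "same_orbit p x z"
  using assms unfolding same_orbit_def by (metis comp_apply funpow_add)

lemma same_orbit_closed:
  assumes "\<And>y. y \<in> X \<Longrightarrow> p y \<in> X" "x \<in> X" "same_orbit p x y"
  shows "y \<in> X"
proof -
  have "(p ^^ n) x \<in> X" for n
    by (induction n) (use assms in auto)
  then show ?thesis using assms(3) by (auto simp: same_orbit_def)
qed

lemma same_orbit_invariant:
  assumes step: "\<And>y. y \<in> D \<Longrightarrow> p y \<in> D \<and> R y (p y)"
    and R: "\<And>y. y \<in> D \<Longrightarrow> R y y"
      "\<And>x y z. x \<in> D \<Longrightarrow> y \<in> D \<Longrightarrow> z \<in> D \<Longrightarrow> R x y \<Longrightarrow> R y z \<Longrightarrow> R x z"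
    and x: "x \<in> D" and xy: "same_orbit p x y"
  shows "R x y"
proof -
  have "(p ^^ n) x \<in> D \<and> R x ((p ^^ n) x)" for n
  proof (induction n)
    case 0
    show ?case using R(1) x by simp
  next
    case (Suc n)
    then show ?case using step[of "(p ^^ n) x"] R(2)[OF x, of "(p ^^ n) x" "p ((p ^^ n) x)"] by simp
  qed
  then show ?thesis using xy by (auto simp: same_orbit_def)
qed

locale finite_perm =
  fixes D :: "'a set" and p :: "'a \<Rightarrow> 'a"
  assumes finite_D: "finite D" and bij_p: "bij_betw p D D"
begin

lemma p_in: "x \<in> D \<Longrightarrow> p x \<in> D"
  using bij_p by (auto simp: bij_betw_def)

lemma funpow_in: "x \<in> D \<Longrightarrow> (p ^^ n) x \<in> D"
  by (induction n) (auto intro: p_in)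

lemma same_orbit_in: "x \<in> D \<Longrightarrow> same_orbit p x y \<Longrightarrow> y \<in> D"
  by (auto simp: same_orbit_def funpow_in)

lemma funpow_period:
  assumes "x \<in> D"
  obtains m where "m > 0" "(p ^^ m) x = x"
proof -
  have "finite (range (\<lambda>n. (p ^^ n) x))"
    by (rule finite_subset[OF _ finite_D]) (use assms funpow_in in auto)
  then have "\<not> inj (\<lambda>n. (p ^^ n) x)"
    using finite_imageD by blast
  then obtain i j where ij: "i < j" "(p ^^ i) x = (p ^^ j) x"
    by (auto simp: inj_on_def) (metis nat_neq_iff)
  have "(p ^^ i) ((p ^^ (j - i)) x) = (p ^^ i) x"
    using ij by (metis comp_apply funpow_add le_add_diff_inverse less_imp_le_nat)
  moreover have "inj_on (p ^^ i) D"
    using bij_p by (rule bij_betw_imp_inj_on[OF bij_betw_funpow])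
  ultimately have "(p ^^ (j - i)) x = x"
    using assms funpow_in by (auto dest: inj_onD)
  then show thesis using ij(1) that[of "j - i"] by simp
qed

lemma same_orbit_sym:
  assumes "x \<in> D" "same_orbit p x y"
  shows "same_orbit p y x"
proof -
  obtain n where n: "(p ^^ n) x = y" using assms(2) by (auto simp: same_orbit_def)
  obtain m where m: "m > 0" "(p ^^ m) x = x" using funpow_period[OF assms(1)] .
  have per: "(p ^^ (k * m)) x = x" for k
    by (induction k) (auto simp: funpow_add m(2) add.commute)
  \<comment> \<open>From \<open>y\<close> another \<open>n * m - n\<close> steps complete
    \<open>n\<close> full periods; as \<open>m\<close> is positive, the truncated subtraction is
    exact.\<close>
  have "(p ^^ (n * m - n)) y = (p ^^ (n * m - n + n)) x"
    by (simp add: n funpow_add)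
  also have "n * m - n + n = n * m" using m(1) by simp
  finally show ?thesis using per by (auto simp: same_orbit_def)
qed

lemma equiv_same_orbit: "equiv D {(x, y). x \<in> D \<and> y \<in> D \<and> same_orbit p x y}"
  by (rule equivI) (auto simp: refl_on_def sym_def trans_def intro: same_orbit_sym same_orbit_trans)

end

text \<open>The situation is symmetric in \<open>p\<close> and \<open>q\<close>
  (\<open>perm_transpose_sym\<close>), so every fact about merging orbits can also be read as one
  about splitting them.\<close>

locale perm_transpose = finite_perm D p + q: finite_perm D q
  for D :: "'a set" and p q :: "'a \<Rightarrow> 'a" +
  fixes a b :: 'a
  assumes a: "a \<in> D" and b: "b \<in> D" and ab: "a \<noteq> b"
    and q: "\<And>x. x \<in> D \<Longrightarrow> q x = p (if x = a then b else if x = b then a else x)"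
begin

text \<open>Let \<open>b\<close> be reached from \<open>a\<close> first after \<open>k\<close>
  steps. On the arc from \<open>p a\<close> to \<open>b\<close> the map \<open>q\<close> follows
  \<open>p\<close>, and \<open>q b = p a\<close> closes the arc to a cycle of \<open>q\<close>. The
  arc is explicit because later sums run along it.\<close>

lemma split_orbit:
  assumes pab: "same_orbit p a b"
  obtains k where "k > 0" "(p ^^ k) a = b" "inj_on (\<lambda>i. (p ^^ i) a) {1..k}"
    "a \<notin> (\<lambda>i. (p ^^ i) a) ` {1..k}"
    "{x. same_orbit q b x} = (\<lambda>i. (p ^^ i) a) ` {1..k}"
proof -
  define k where "k = (LEAST k. (p ^^ k) a = b)"
  have ex: "\<exists>k. (p ^^ k) a = b" using pab by (auto simp: same_orbit_def)
  have k: "(p ^^ k) a = b" unfolding k_def using ex by (rule LeastI_ex)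
  have least: "k \<le> i" if "(p ^^ i) a = b" for i
    unfolding k_def using that by (rule Least_le)
  have pos: "k > 0" using k ab by (cases k) auto
  define X where "X = (\<lambda>i. (p ^^ i) a) ` {1..k}"
  \<comment> \<open>Minimality of \<open>k\<close>: a repetition at i < j would allow a loop to be
    left out, so that \<open>b\<close> is reached after k - j + i < k steps.\<close>
  have shift: "(p ^^ (k - j + i)) a = b" if "(p ^^ i) a = (p ^^ j) a" "j \<le> k" for i j
    using that k by (metis comp_apply funpow_add le_add_diff_inverse2)
  have inj: "inj_on (\<lambda>i. (p ^^ i) a) {1..k}"
  proof (rule linorder_inj_onI)
    fix i j assume "i < j" "i \<in> {1..k}" "j \<in> {1..k}"
    then show "(p ^^ i) a \<noteq> (p ^^ j) a"
      using shift[of i j] least[of "k - j + i"] by auto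
  qed linarith
  have nota: "a \<notin> X"
  proof
    assume "a \<in> X"
    then obtain i where "1 \<le> i" "i \<le> k" "(p ^^ 0) a = (p ^^ i) a" by (auto simp: X_def)
    then show False using shift[of 0 i] least[of "k - i"] by auto
  qed
  have qstep: "q ((p ^^ i) a) = (p ^^ Suc i) a" if "1 \<le> i" "i < k" for i
  proof -
    have "(p ^^ i) a \<noteq> a" using nota that unfolding X_def by (metis atLeastAtMost_iff imageI less_imp_le_nat)
    moreover have "(p ^^ i) a \<noteq> b" using least[of i] that by auto
    ultimately show ?thesis by (simp add: q a b funpow_in)
  qed
  have qb: "q b = p a" using ab by (simp add: q a b funpow_in)
  have sub: "same_orbit q b ((p ^^ i) a)" if "1 \<le> i" "i \<le> k" for i
    using that
  proof (induction i)
    case (Suc i)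
    show ?case
    proof (cases "i = 0")
      case True
      then show ?thesis using same_orbit_step[of q b] qb by simp
    next
      case False
      then have "same_orbit q b ((p ^^ i) a)" using Suc by simp
      then show ?thesis using qstep[of i] False Suc.prems same_orbit_step[of q "(p ^^ i) a"]
        by (metis One_nat_def Suc_leI Suc_le_lessD neq0_conv same_orbit_trans)
    qed
  qed simp
  have closed: "q x \<in> X" if x: "x \<in> X" for x
  proof -
    obtain i where i: "1 \<le> i" "i \<le> k" "x = (p ^^ i) a" using x by (auto simp: X_def)
    show ?thesis
    proof (cases "i = k")
      case True
      then have "q x = (p ^^ 1) a" using i k qb by simp
      then show ?thesis using pos unfolding X_def
        by (metis One_nat_def Suc_leI atLeastAtMost_iff imageI order_refl)
    next
      case False
      then have "q x = (p ^^ Suc i) a" using qstep[of i] i by simp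
      moreover have "Suc i \<in> {1..k}" using i False by auto
      ultimately show ?thesis unfolding X_def by blast
    qed
  qed
  have "b \<in> X" using k pos by (auto simp: X_def image_iff intro!: bexI[of _ k])
  then have "{x. same_orbit q b x} = X"
    using sub same_orbit_closed[of X q b] closed by (auto simp: X_def)
  then show thesis using that[of k] pos k inj nota by (simp add: X_def)
qed

lemma separated_after:
  assumes "same_orbit p a b"
  shows "\<not> same_orbit q a b"
proof
  assume "same_orbit q a b"
  then have "same_orbit q b a" using q.same_orbit_sym a by blast
  moreover have "\<not> same_orbit q b a"
    by (rule split_orbit[OF assms]) blast
  ultimately show False by blast
qed

text \<open>If \<open>a\<close> and \<open>b\<close> lie on different cycles of \<open>p\<close>,
  then \<open>q\<close> crosses over at each of them and runs through the other cycle before coming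
  back: the two cycles fuse and all others stay.\<close>

lemma merge:
  assumes sep: "\<not> same_orbit p a b" and x: "x \<in> D"
  shows "same_orbit q x y \<longleftrightarrow>
    same_orbit p x y \<or> ((same_orbit p a x \<or> same_orbit p b x) \<and> (same_orbit p a y \<or> same_orbit p b y))"
proof -
  \<comment> \<open>From \<open>t\<close> the map \<open>q\<close> jumps to \<open>p s\<close> and
    then follows the cycle of \<open>s\<close> up to \<open>s\<close> itself, since that cycle
    avoids \<open>t\<close>.\<close>
  have reach: "same_orbit q t s"
    if ts: "{s, t} = {a, b}" "s \<noteq> t" for s t
  proof -
    have sD: "s \<in> D" and tD: "t \<in> D" using ts a b by auto
    have nst: "\<not> same_orbit p s t"
      using ts sep same_orbit_sym[OF sD, of t] by (auto simp: doubleton_eq_iff)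
    have qt: "q t = p s" using ts ab a b q[of t] by (auto simp: doubleton_eq_iff)
    have step: "q z = p z" if "z \<in> D" "z \<noteq> s" "z \<noteq> t" for z
      using that ts q[of z] by (auto simp: doubleton_eq_iff)
    obtain m where m: "m > 0" "(p ^^ m) s = s" using funpow_period[OF sD] .
    define j where "j = (LEAST j. (p ^^ Suc j) s = s)"
    have j: "(p ^^ Suc j) s = s" unfolding j_def
      by (rule LeastI_ex) (metis m gr0_implies_Suc)
    have jl: "j \<le> i" if "(p ^^ Suc i) s = s" for i
      unfolding j_def using that by (rule Least_le)
    have "same_orbit q t ((p ^^ Suc i) s)" if "i \<le> j" for i
      using that
    proof (induction i)
      case 0
      then show ?case using same_orbit_step[of q t] qt by simp
    next
      case (Suc i)
      have "(p ^^ Suc i) s \<noteq> s" using jl[of i] Suc.prems by auto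
      moreover have "(p ^^ Suc i) s \<noteq> t" using nst unfolding same_orbit_def by blast
      ultimately have "q ((p ^^ Suc i) s) = (p ^^ Suc (Suc i)) s"
        using step[OF funpow_in[OF sD, of "Suc i"]] by simp
      then show ?case using Suc same_orbit_step[of q "(p ^^ Suc i) s"]
        by (metis Suc_leD same_orbit_trans)
    qed
    from this[of j] j show ?thesis by simp
  qed
  have qba: "same_orbit q b a" and qab: "same_orbit q a b"
    using reach[of a b] reach[of b a] ab by auto
  \<comment> \<open>A single step of \<open>p\<close> is a path of \<open>q\<close>: at
    \<open>a\<close> or \<open>b\<close> it is the \<open>q\<close>-step of the other point, and
    \<open>q\<close> joins the two.\<close>
  have pq: "same_orbit q u w" if "u \<in> D" "same_orbit p u w" for u w
  proof (rule same_orbit_invariant[where D=D and p=p, OF _ _ _ that])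
    fix z assume z: "z \<in> D"
    have "same_orbit q z (p z)"
    proof (cases "z = a \<or> z = b")
      case True
      then have "p z = q b \<and> same_orbit q z b \<or> p z = q a \<and> same_orbit q z a"
        using qab qba ab a b q[of a] q[of b] by auto
      then show ?thesis
        using same_orbit_trans[OF _ same_orbit_step, of q z] by auto
    next
      case False
      then show ?thesis using same_orbit_step[of q z] q[of z] z by simp
    qed
    then show "p z \<in> D \<and> same_orbit q z (p z)" using p_in z by blast
  qed (auto intro: same_orbit_trans)
  let ?AB = "\<lambda>z. same_orbit p a z \<or> same_orbit p b z"
  show ?thesis
  proof
    assume "same_orbit q x y"
    then show "same_orbit p x y \<or> (?AB x \<and> ?AB y)"
    proof (rule same_orbit_invariant[where D=D and p=q, rotated 4])
      fix z assume z: "z \<in> D"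
      have "same_orbit p z (q z) \<or> (?AB z \<and> ?AB (q z))"
        using q[of z] z same_orbit_step[of p] by auto
      then show "q z \<in> D \<and> (same_orbit p z (q z) \<or> (?AB z \<and> ?AB (q z)))"
        using q.p_in z by blast
    next
      fix r s t assume "r \<in> D" "s \<in> D" "t \<in> D"
        "same_orbit p r s \<or> (?AB r \<and> ?AB s)" "same_orbit p s t \<or> (?AB s \<and> ?AB t)"
      then show "same_orbit p r t \<or> (?AB r \<and> ?AB t)"
        by (meson same_orbit_trans same_orbit_sym)
    qed (use x in auto)
  next
    assume "same_orbit p x y \<or> (?AB x \<and> ?AB y)"
    then show "same_orbit q x y"
      using pq x a b qab qba by (meson same_orbit_trans q.same_orbit_sym)
  qed
qed

end

lemma perm_transpose_sym:
  assumes "perm_transpose D p q a b"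
  shows "perm_transpose D q p a b"
proof -
  interpret perm_transpose D p q a b by fact
  show ?thesis by unfold_locales (use a b ab q in \<open>auto\<close>)
qed

text \<open>The classes of \<open>a\<close> and \<open>b\<close> are replaced by their union and no
  other class changes; this turns \<open>merge\<close> into a count of orbits.\<close>

lemma card_quotient_merge:
  assumes fin: "finite D" and eq: "equiv D R" and ab: "a \<in> D" "b \<in> D" "(a, b) \<notin> R"
    and R': "equiv D R'"
      "\<And>x y. (x, y) \<in> R' \<longleftrightarrow> (x, y) \<in> R \<or> (x \<in> R `` {a} \<union> R `` {b} \<and> y \<in> R `` {a} \<union> R `` {b})"
  shows "card (D // R) = Suc (card (D // R'))"
proof -
  let ?A = "R `` {a}" and ?B = "R `` {b}"
  let ?Q = "D // R - {?A, ?B}"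
  have cls: "R' `` {x} = (if x \<in> ?A \<union> ?B then ?A \<union> ?B else R `` {x})" if "x \<in> D" for x
  proof (cases "x \<in> ?A \<union> ?B")
    case True
    then have "R `` {x} = ?A \<or> R `` {x} = ?B"
      using eq by (auto dest: equiv_class_eq)
    then have "R `` {x} \<subseteq> ?A \<union> ?B" by blast
    then show ?thesis using True R'(2) by auto
  next
    case False
    then show ?thesis using R'(2) by auto
  qed
  have mem: "R `` {x} \<in> {?A, ?B} \<longleftrightarrow> x \<in> ?A \<union> ?B" if "x \<in> D" for x
    using that ab eq by (auto simp: eq_equiv_class_iff[OF eq] equiv_def dest: symD)
  have q': "D // R' = insert (?A \<union> ?B) ?Q"
  proof (intro equalityI subsetI)
    fix X assume "X \<in> D // R'"
    then obtain x where x: "x \<in> D" "X = R' `` {x}" by (auto elim: quotientE)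
    then show "X \<in> insert (?A \<union> ?B) ?Q"
      using cls[of x] mem[of x] quotientI[of x D R] by (cases "x \<in> ?A \<union> ?B") auto
  next
    fix X assume X: "X \<in> insert (?A \<union> ?B) ?Q"
    show "X \<in> D // R'"
    proof (cases "X = ?A \<union> ?B")
      case True
      have "a \<in> ?A" using equiv_class_self[OF eq ab(1)] .
      then show ?thesis using True cls[OF ab(1)] quotientI[OF ab(1), of R'] by simp
    next
      case False
      then have "X \<in> ?Q" using X by simp
      then obtain x where x: "x \<in> D" "X = R `` {x}" "X \<notin> {?A, ?B}" by (blast elim: quotientE)
      then show ?thesis using cls[of x] mem[of x] quotientI[of x D R'] by simp
    qed
  qed
  have finq: "finite (D // R)"
    using finite_quotient[OF fin] eq by (auto simp: equiv_def refl_on_def)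
  have AB: "?A \<noteq> ?B" using ab eq by (simp add: eq_equiv_class_iff)
  have nin: "?A \<union> ?B \<notin> ?Q"
  proof
    assume "?A \<union> ?B \<in> ?Q"
    then obtain x where x: "x \<in> D" "?A \<union> ?B = R `` {x}" "?A \<union> ?B \<noteq> ?A" by (auto elim!: quotientE)
    have "a \<in> R `` {x}" using equiv_class_self[OF eq ab(1)] x by blast
    then have "R `` {x} = ?A" using eq by (auto dest: equiv_class_eq)
    then show False using x by simp
  qed
  have "card (D // R) = card ?Q + 2"
  proof -
    have sub: "{?A, ?B} \<subseteq> D // R" using ab by (auto intro: quotientI)
    then have "card ?Q = card (D // R) - card {?A, ?B}"
      by (intro card_Diff_subset) auto
    moreover have "card {?A, ?B} \<le> card (D // R)" using sub finq by (rule card_mono[rotated])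
    ultimately show ?thesis using AB by simp
  qed
  moreover have "card (D // R') = Suc (card ?Q)"
    unfolding q' using nin finq by simp
  ultimately show ?thesis by simp
qed

section \<open>The tour permutation of an edge set\<close>

section \<open>Ribbon graphs and the permutations of their darts\<close>

text \<open>A non-planar ribbon graph has an edge by the convention of \<open>planar_ribbon\<close>
  for the edgeless graph.\<close>

locale ribbon =
  fixes V :: "'v set" and E :: "'e set" and ends :: "'e \<Rightarrow> 'v \<times> 'v"
    and rot :: "'v \<Rightarrow> 'e \<Rightarrow> 'e"
  assumes ribbon_graph: "ribbon_graph V E ends rot" and E_nonempty: "E \<noteq> {}"
begin

abbreviation conn :: "'e set \<Rightarrow> 'v \<Rightarrow> 'v \<Rightarrow> bool" where
  "conn F u w \<equiv> (u, w) \<in> (adj_rel F ends)\<^sup>*"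

abbreviation D :: "('v \<times> 'e) set" where
  "D \<equiv> darts E ends"

abbreviation tree :: "'e set \<Rightarrow> bool" where
  "tree T \<equiv> spanning_tree V E ends T"

abbreviation step :: "'e set \<Rightarrow> 'v \<times> 'e \<Rightarrow> 'v \<times> 'e" where
  "step F \<equiv> bernardi_step ends rot F"

abbreviation rel :: "'e set \<Rightarrow> 'v \<times> 'e \<Rightarrow> 'v \<times> 'e \<Rightarrow> bool" where
  "rel F \<equiv> same_orbit (step F)"

abbreviation opp :: "'e \<Rightarrow> 'v \<Rightarrow> 'v" where
  "opp \<equiv> other ends"

lemma finite_V: "finite V" and finite_E: "finite E" and V_nonempty: "V \<noteq> {}"
  and connected: "connected_on V E ends"
  using ribbon_graph by (auto simp: ribbon_graph_def graph_def)

lemma ends_V: "e \<in> E \<Longrightarrow> fst (ends e) \<in> V" "e \<in> E \<Longrightarrow> snd (ends e) \<in> V"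
  "e \<in> E \<Longrightarrow> fst (ends e) \<noteq> snd (ends e)"
  using ribbon_graph by (auto simp: ribbon_graph_def graph_def)

lemma dart_iff: "(u, e) \<in> D \<longleftrightarrow> e \<in> E \<and> incident ends e u"
  by (simp add: darts_def)

lemma dart_V: "(u, e) \<in> D \<Longrightarrow> u \<in> V"
  using ends_V by (auto simp: dart_iff incident_def)

lemma dart_E: "(u, e) \<in> D \<Longrightarrow> e \<in> E"
  by (simp add: dart_iff)

lemma opp_dart: "(u, e) \<in> D \<Longrightarrow> (opp e u, e) \<in> D"
  and opp_neq: "(u, e) \<in> D \<Longrightarrow> opp e u \<noteq> u"
  and opp_opp: "(u, e) \<in> D \<Longrightarrow> opp e (opp e u) = u"
  using ends_V(3)[of e] by (auto simp: dart_iff incident_def other_def)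

lemma dart_cases: "(u, e) \<in> D \<Longrightarrow> (w, e) \<in> D \<longleftrightarrow> w = u \<or> w = opp e u"
  using ends_V(3)[of e] by (auto simp: dart_iff incident_def other_def)

lemma edge_dart: "e \<in> E \<Longrightarrow> \<exists>u. (u, e) \<in> D"
  by (auto simp: dart_iff incident_def)

lemma edges_at_eq: "edges_at E ends u = {e. (u, e) \<in> D}"
  by (auto simp: edges_at_def dart_iff)

lemma finite_D: "finite D"
proof (rule finite_subset)
  show "D \<subseteq> V \<times> E" using dart_V dart_E by auto
qed (simp add: finite_V finite_E)

lemma adj_iff:
  assumes "F \<subseteq> E"
  shows "(u, w) \<in> adj_rel F ends \<longleftrightarrow> (\<exists>e\<in>F. (u, e) \<in> D \<and> w = opp e u)"
proof -
  have "ends e = (u, w) \<or> ends e = (w, u) \<longleftrightarrow> (u, e) \<in> D \<and> w = opp e u" if "e \<in> F" for e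
    using that assms ends_V(3)[of e]
    by (cases "ends e") (auto simp: dart_iff incident_def other_def)
  then show ?thesis by (auto simp: adj_rel_def)
qed

lemma conn_sym: "conn F u w \<Longrightarrow> conn F w u"
proof -
  have "sym (adj_rel F ends)" by (auto simp: sym_def adj_rel_def)
  then show "conn F u w \<Longrightarrow> conn F w u" by (meson sym_rtrancl symE)
qed

lemma conn_mono: "F \<subseteq> F' \<Longrightarrow> conn F u w \<Longrightarrow> conn F' u w"
  by (erule rtrancl_mono[THEN subsetD, rotated]) (auto simp: adj_rel_def)

lemma conn_edge: "F \<subseteq> E \<Longrightarrow> e \<in> F \<Longrightarrow> (u, e) \<in> D \<Longrightarrow> conn F u (opp e u)"
  using adj_iff by blast

lemma rot_in: "(u, e) \<in> D \<Longrightarrow> (u, rot u e) \<in> D"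
  using ribbon_graph dart_V[of u e] unfolding ribbon_graph_def edges_at_eq
  by (auto simp: bij_betw_def)

lemma rot_inj: "(u, e) \<in> D \<Longrightarrow> (u, e') \<in> D \<Longrightarrow> rot u e = rot u e' \<Longrightarrow> e = e'"
  using ribbon_graph dart_V[of u e] unfolding ribbon_graph_def edges_at_eq
  by (auto simp: bij_betw_def inj_on_def)

lemma rot_transitive: "(u, e) \<in> D \<Longrightarrow> (u, e') \<in> D \<Longrightarrow> \<exists>n. (rot u ^^ n) e = e'"
  using ribbon_graph dart_V[of u e] unfolding ribbon_graph_def edges_at_eq by auto

lemma rot_funpow_in: "(u, e) \<in> D \<Longrightarrow> (u, (rot u ^^ n) e) \<in> D"
  by (induction n) (auto intro: rot_in)

lemma step_simps:
  "e \<in> F \<Longrightarrow> step F (u, e) = (opp e u, rot (opp e u) e)"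
  "e \<notin> F \<Longrightarrow> step F (u, e) = (u, rot u e)"
  by (auto simp: bernardi_step_def Let_def)

lemma step_in: "d \<in> D \<Longrightarrow> step F d \<in> D"
  by (cases d; cases "snd d \<in> F") (auto simp: step_simps intro: rot_in opp_dart)

text \<open>A step swaps the ends of an edge of \<open>F\<close>, which is an involution on darts,
  and then rotates. In the proof \<open>?s\<close> is the vertex after the swap.\<close>

lemma step_inj: "inj_on (step F) D"
proof (rule inj_onI, clarify)
  fix u e u' e' assume d: "(u, e) \<in> D" "(u', e') \<in> D" and eq: "step F (u, e) = step F (u', e')"
  let ?s = "\<lambda>u e. if e \<in> F then opp e u else u"
  have w: "?s u e = ?s u' e'" "rot (?s u e) e = rot (?s u e) e'"
    using eq by (auto simp: bernardi_step_def Let_def split: if_splits)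
  have "(?s u e, e) \<in> D" "(?s u' e', e') \<in> D"
    using d by (auto intro: opp_dart)
  then have "e = e'" using w rot_inj[of "?s u e" e e'] by metis
  then show "u = u' \<and> e = e'" using w(1) d opp_opp by (metis (full_types))
qed

lemma finite_perm_step: "finite_perm D (step F)"
proof
  have "step F ` D = D"
    using finite_D step_inj step_in by (intro endo_inj_surj) auto
  then show "bij_betw (step F) D D" using step_inj by (simp add: bij_betw_def)
qed (rule finite_D)

lemma rel_in: "d \<in> D \<Longrightarrow> rel F d d' \<Longrightarrow> d' \<in> D"
  using finite_perm.same_orbit_in[OF finite_perm_step] .

lemma rel_sym: "d \<in> D \<Longrightarrow> rel F d d' \<Longrightarrow> rel F d' d"
  using finite_perm.same_orbit_sym[OF finite_perm_step] .

text \<open>Once \<open>f\<close> belongs to \<open>F\<close>, a dart of \<open>f\<close> is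
  replaced by its opposite before the rotation, so the images of the two darts are
  exchanged.\<close>

lemma perm_transpose_step:
  assumes uf: "(u, f) \<in> D" and f: "f \<notin> F"
  shows "perm_transpose D (step F) (step (insert f F)) (u, f) (opp f u, f)"
proof -
  interpret p: finite_perm D "step F" by (rule finite_perm_step)
  interpret q: finite_perm D "step (insert f F)" by (rule finite_perm_step)
  show ?thesis
  proof
    fix x assume x: "x \<in> D"
    show "step (insert f F) x =
      step F (if x = (u, f) then (opp f u, f) else if x = (opp f u, f) then (u, f) else x)"
      using x uf f opp_opp[OF uf] dart_cases[OF uf, of "fst x"]
      by (cases x) (auto simp: bernardi_step_def Let_def)
  qed (use uf opp_dart opp_neq[OF uf] in auto)
qed

lemma rel_insert_separated:
  assumes "(u, f) \<in> D" "f \<notin> F" "rel F (u, f) (opp f u, f)"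
  shows "\<not> rel (insert f F) (u, f) (opp f u, f)"
  using perm_transpose.separated_after[OF perm_transpose_step[OF assms(1,2)] assms(3)] .

lemma rel_insert_merge:
  assumes "(u, f) \<in> D" "f \<notin> F" "\<not> rel F (u, f) (opp f u, f)" "x \<in> D"
  shows "rel (insert f F) x y \<longleftrightarrow> rel F x y \<or>
    ((rel F (u, f) x \<or> rel F (opp f u, f) x) \<and> (rel F (u, f) y \<or> rel F (opp f u, f) y))"
  using perm_transpose.merge[OF perm_transpose_step[OF assms(1,2)] assms(3,4)] .

text \<open>If \<open>f\<close> splits an orbit of \<open>F\<close>, its removal merges the parts
  again: \<open>merge\<close> read from \<open>insert f F\<close> back to \<open>F\<close>.\<close>

lemma rel_insert_split:
  assumes "(u, f) \<in> D" "f \<notin> F" "rel F (u, f) (opp f u, f)" "x \<in> D"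
  shows "rel F x y \<longleftrightarrow> rel (insert f F) x y \<or>
    ((rel (insert f F) (u, f) x \<or> rel (insert f F) (opp f u, f) x) \<and>
     (rel (insert f F) (u, f) y \<or> rel (insert f F) (opp f u, f) y))"
  using perm_transpose.merge[OF perm_transpose_sym[OF perm_transpose_step[OF assms(1,2)]]
      rel_insert_separated[OF assms(1-3)] assms(4)] .

lemma rel_vertex:
  assumes step: "\<And>e. (u, e) \<in> D \<Longrightarrow> rel F (u, e) (u, rot u e)"
    and d: "(u, e) \<in> D" "(u, e') \<in> D"
  shows "rel F (u, e) (u, e')"
proof -
  have "rel F (u, e) (u, (rot u ^^ n) e)" for n
  proof (induction n)
    case (Suc n)
    then show ?case
      using same_orbit_trans[OF _ step, of "(u, e)" "(rot u ^^ n) e"] rot_funpow_in[OF d(1)] by simp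
  qed simp
  then show ?thesis using rot_transitive[OF d] by blast
qed

lemma rel_conn:
  assumes F: "F \<subseteq> E" and d: "d \<in> D" and r: "rel F d d'"
  shows "conn F (fst d) (fst d')"
proof (rule same_orbit_invariant[where D=D and p="step F", OF _ _ _ d r])
  fix y assume y: "y \<in> D"
  obtain u e where ue: "y = (u, e)" by (cases y)
  have "conn F (fst y) (fst (step F y))"
    using y ue conn_edge[OF F] by (cases "e \<in> F") (auto simp: step_simps)
  then show "step F y \<in> D \<and> conn F (fst y) (fst (step F y))" using step_in[OF y] by blast
qed auto

section \<open>Forests, exchange of tree edges, and the tours around forests\<close>

section \<open>Spanning trees\<close>

definition inside :: "'e set \<Rightarrow> 'v set \<Rightarrow> 'e set" where
  "inside F S = {f \<in> F. fst (ends f) \<in> S \<and> snd (ends f) \<in> S}"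

lemma conn_leaves:
  assumes "F \<subseteq> E" "u \<in> S" "w \<notin> S" "conn F u w"
  shows "\<exists>f x. f \<in> F \<and> (x, f) \<in> D \<and> x \<in> S \<and> opp f x \<notin> S"
  using assms(4,3)
proof (induction rule: rtrancl_induct)
  case base
  then show ?case using assms by simp
next
  case (step y z)
  show ?case
  proof (cases "y \<in> S")
    case True
    obtain f where "f \<in> F" "(y, f) \<in> D" "z = opp f y"
      using step(2) adj_iff[OF assms(1)] by auto
    then show ?thesis using step(4) True by blast
  next
    case False
    then show ?thesis using step(3) by blast
  qed
qed

text \<open>\<open>S\<close> grows to \<open>V\<close> one vertex at a time along edges of
  \<open>F\<close>, and each new vertex consumes an edge that was not inside the set before. This
  count gives both the edge bound inside a tree and the bridge property.\<close>

lemma card_outside: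
  assumes F: "F \<subseteq> E" "connected_on V F ends" and S: "S \<subseteq> V" "S \<noteq> {}"
  shows "card (V - S) \<le> card (F - inside F S)"
  using S
proof (induction "card (V - S)" arbitrary: S)
  case 0
  then show ?case by simp
next
  case (Suc n)
  obtain u where u: "u \<in> S" using Suc by blast
  have "V - S \<noteq> {}" using Suc(2) by force
  then obtain w where w: "w \<in> V" "w \<notin> S" by blast
  have "conn F u w" using F(2) u w Suc(3) by (auto simp: connected_on_def)
  then obtain f x where f: "f \<in> F" "(x, f) \<in> D" "x \<in> S" "opp f x \<notin> S"
    using conn_leaves[OF F(1) u w(2)] by blast
  let ?S = "insert (opp f x) S"
  have y: "opp f x \<in> V" using opp_dart[OF f(2)] dart_V by blast
  have eq: "V - S = insert (opp f x) (V - ?S)" using y f(4) by auto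
  have "card (V - S) = Suc (card (V - ?S))"
    by (subst eq, subst card_insert_disjoint) (use finite_V in auto)
  then have n: "n = card (V - ?S)" using Suc(2) by simp
  have "card (V - ?S) \<le> card (F - inside F ?S)" using Suc y by (intro Suc(1)[OF n]) auto
  moreover have "F - inside F ?S \<subset> F - inside F S"
  proof -
    have "f \<in> inside F ?S" "f \<notin> inside F S"
      using f by (auto simp: inside_def dart_iff incident_def other_def split: if_splits)
    moreover have "inside F S \<subseteq> inside F ?S" by (auto simp: inside_def)
    ultimately show ?thesis using f(1) by (auto simp: inside_def)
  qed
  then have "card (F - inside F ?S) < card (F - inside F S)"
    using F(1) finite_E finite_subset by (intro psubset_card_mono) blast+
  ultimately show ?case using Suc(2) n by simp
qed

lemma tree_E: "tree T \<Longrightarrow> T \<subseteq> E" and tree_card: "tree T \<Longrightarrow> card T + 1 = card V"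
  and tree_connected: "tree T \<Longrightarrow> connected_on V T ends"
  by (auto simp: spanning_tree_def)

lemma finite_tree: "tree T \<Longrightarrow> finite T"
  using tree_E finite_E finite_subset by blast

lemma tree_conn: "tree T \<Longrightarrow> u \<in> V \<Longrightarrow> w \<in> V \<Longrightarrow> conn T u w"
  using tree_connected by (auto simp: connected_on_def)

text \<open>By \<open>card_outside\<close> at least |V| - |S| edges of \<open>T\<close> are not
  inside \<open>S\<close>, and \<open>T\<close> has |V| - 1 edges altogether.\<close>

lemma card_inside_tree:
  assumes T: "tree T" and S: "S \<subseteq> V" "S \<noteq> {}"
  shows "card (inside T S) + 1 \<le> card S"
proof -
  have "card (V - S) \<le> card (T - inside T S)"
    using card_outside[OF tree_E[OF T] tree_connected[OF T] S] .
  moreover have "card (T - inside T S) = card T - card (inside T S)"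
    using finite_tree[OF T] by (intro card_Diff_subset) (auto simp: inside_def)
  moreover have "card (inside T S) \<le> card T"
    using finite_tree[OF T] by (intro card_mono) (auto simp: inside_def)
  moreover have "card (V - S) = card V - card S" "card S \<le> card V"
    using S finite_V card_mono[OF finite_V S(1)] card_Diff_subset[OF finite_subset[OF S(1) finite_V] S(1)]
    by simp_all
  ultimately show ?thesis using tree_card[OF T] by linarith
qed

lemma tree_bridge:
  assumes T: "tree T" and h: "h \<in> T" "(u, h) \<in> D"
  shows "\<not> conn (T - {h}) u (opp h u)"
proof
  assume c: "conn (T - {h}) u (opp h u)"
  have sub: "T \<subseteq> E" "T - {h} \<subseteq> E" using tree_E[OF T] by auto
  have "adj_rel T ends \<subseteq> (adj_rel (T - {h}) ends)\<^sup>*"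
  proof clarify
    fix x y assume "(x, y) \<in> adj_rel T ends"
    then obtain k where k: "k \<in> T" "(x, k) \<in> D" "y = opp k x" using adj_iff[OF sub(1)] by blast
    show "conn (T - {h}) x y"
    proof (cases "k = h")
      case True
      then show ?thesis using k dart_cases[OF h(2), of x] c conn_sym[OF c] opp_opp[OF h(2)] by auto
    next
      case False
      then show ?thesis using k conn_edge[OF sub(2), of k x] by blast
    qed
  qed
  then have "(adj_rel T ends)\<^sup>* \<subseteq> (adj_rel (T - {h}) ends)\<^sup>*"
    by (metis rtrancl_idemp rtrancl_mono)
  then have con: "connected_on V (T - {h}) ends"
    using tree_connected[OF T] by (auto simp: connected_on_def)
  have u: "u \<in> V" using h dart_V by blast
  have "card (V - {u}) \<le> card (T - {h} - inside (T - {h}) {u})"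
    using card_outside[OF sub(2) con, of "{u}"] u by simp
  also have "\<dots> \<le> card (T - {h})" using finite_tree[OF T] by (intro card_mono) auto
  finally have "card V - 1 \<le> card T - 1" using u h finite_V finite_tree[OF T] by simp
  moreover have "card T > 0" using h finite_tree[OF T] card_gt_0_iff by blast
  ultimately show False using tree_card[OF T] by linarith
qed

lemma conn_remove:
  assumes F: "F \<subseteq> E" and h: "(x, h) \<in> D" and c: "conn F u w" "\<not> conn (F - {h}) u w"
  shows "(conn (F - {h}) u x \<and> conn (F - {h}) (opp h x) w) \<or>
         (conn (F - {h}) u (opp h x) \<and> conn (F - {h}) x w)"
  using c
proof (induction rule: rtrancl_induct)
  case base
  then show ?case by simp
next
  case (step y z)
  obtain k where k: "k \<in> F" "(y, k) \<in> D" "z = opp k y" using step(2) adj_iff[OF F] by blast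
  have F': "F - {h} \<subseteq> E" using F by blast
  show ?case
  proof (cases "k = h")
    case False
    then have yz: "conn (F - {h}) y z" using conn_edge[OF F', of k y] k by blast
    then have "\<not> conn (F - {h}) u y" using step(4) by (meson rtrancl_trans)
    then show ?thesis using step(3) yz by (meson rtrancl_trans)
  next
    case True
    then have yz: "y = x \<and> z = opp h x \<or> y = opp h x \<and> z = x"
      using k dart_cases[OF h] opp_opp[OF h] by auto
    show ?thesis
    proof (cases "conn (F - {h}) u y")
      case True
      then show ?thesis using yz by auto
    next
      case False
      then show ?thesis using step(3,4) yz by auto
    qed
  qed
qed

lemma tree_exchange:
  assumes T: "tree T" and h: "h \<in> T" and e: "(v, e) \<in> D" "e \<notin> T"
    and sep: "\<not> conn (T - {h}) v (opp e v)"
  shows "tree (insert e (T - {h}))"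
proof -
  let ?T = "insert e (T - {h})"
  have E: "T \<subseteq> E" "?T \<subseteq> E" using tree_E[OF T] dart_E[OF e(1)] by auto
  obtain x where x: "(x, h) \<in> D" using h E edge_dart by blast
  have vs: "v \<in> V" "opp e v \<in> V" using e opp_dart dart_V by blast+
  have ve: "conn ?T v (opp e v)" using conn_edge[OF E(2), of e v] e by blast
  have mono: "conn ?T a b" if "conn (T - {h}) a b" for a b
    using that conn_mono[of "T - {h}" ?T] by blast
  \<comment> \<open>Without \<open>h\<close> the two ends of \<open>e\<close> are joined to
    different ends of \<open>h\<close>, so \<open>e\<close> links the ends of
    \<open>h\<close>.\<close>
  have xy: "conn ?T x (opp h x)"
    using conn_remove[OF E(1) x tree_conn[OF T vs] sep] ve
    by (meson conn_sym mono rtrancl_trans)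
  have "adj_rel T ends \<subseteq> (adj_rel ?T ends)\<^sup>*"
  proof clarify
    fix y z assume "(y, z) \<in> adj_rel T ends"
    then obtain k where k: "k \<in> T" "(y, k) \<in> D" "z = opp k y" using adj_iff[OF E(1)] by blast
    show "conn ?T y z"
    proof (cases "k = h")
      case True
      then show ?thesis using k dart_cases[OF x, of y] xy conn_sym[OF xy] opp_opp[OF x] by auto
    next
      case False
      then show ?thesis using k conn_edge[OF E(2), of k y] by blast
    qed
  qed
  then have "(adj_rel T ends)\<^sup>* \<subseteq> (adj_rel ?T ends)\<^sup>*"
    by (metis rtrancl_idemp rtrancl_mono)
  then have "connected_on V ?T ends"
    using tree_connected[OF T] by (auto simp: connected_on_def)
  moreover have "card ?T = card T"
  proof -
    have "card T > 0" using h finite_tree[OF T] card_gt_0_iff by blast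
    then show ?thesis using h e finite_tree[OF T] by (simp add: card_Diff_singleton)
  qed
  ultimately show ?thesis using E tree_card[OF T] by (simp add: spanning_tree_def)
qed

definition tdist :: "'e set \<Rightarrow> 'v \<Rightarrow> 'v \<Rightarrow> nat" where
  "tdist F u w = (LEAST n. (u, w) \<in> adj_rel F ends ^^ n)"

lemma tdist_relpow: "conn F u w \<Longrightarrow> (u, w) \<in> adj_rel F ends ^^ tdist F u w"
  unfolding tdist_def by (rule LeastI_ex) (simp add: rtrancl_power)

lemma tdist_le: "(u, w) \<in> adj_rel F ends ^^ n \<Longrightarrow> tdist F u w \<le> n"
  unfolding tdist_def by (rule Least_le)

text \<open>A walk that avoids \<open>y\<close> also avoids the edge \<open>h\<close> at
  \<open>y\<close>; otherwise a shorter initial part of it ends in \<open>y\<close>.\<close>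

lemma walk_through:
  assumes F: "F \<subseteq> E" and h: "(y, h) \<in> D" and w: "(x, z) \<in> adj_rel F ends ^^ n" and "y \<noteq> z"
  shows "conn (F - {h}) x z \<or> (\<exists>m<n. (x, y) \<in> adj_rel F ends ^^ m)"
  using w \<open>y \<noteq> z\<close>
proof (induction n arbitrary: z)
  case 0
  then show ?case by simp
next
  case (Suc n)
  obtain w where w: "(x, w) \<in> adj_rel F ends ^^ n" "(w, z) \<in> adj_rel F ends"
    using Suc(2) by auto
  show ?case
  proof (cases "y = w")
    case True
    then show ?thesis using w(1) by blast
  next
    case False
    obtain k where k: "k \<in> F" "(w, k) \<in> D" "z = opp k w" using w(2) adj_iff[OF F] by blast
    have "k \<noteq> h" using k dart_cases[of w h y] h False Suc(3) by auto
    then have "conn (F - {h}) w z" using k F conn_edge[of "F - {h}" k w] by blast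
    then show ?thesis using Suc(1)[OF w(1) False] less_SucI rtrancl_trans by metis
  qed
qed

lemma tdist_less:
  assumes "F \<subseteq> E" "(y, h) \<in> D" "conn F x z" "\<not> conn (F - {h}) x z" "y \<noteq> z"
  shows "tdist F x y < tdist F x z"
  using walk_through[OF assms(1,2) tdist_relpow[OF assms(3)] assms(5)] assms(4) tdist_le
  by (meson le_less_trans)

text \<open>Take the last edge of a shortest walk from \<open>v\<close> to \<open>w\<close>: the
  part before it does not meet \<open>w\<close>, hence does not use this edge, which is a
  bridge.\<close>

lemma separating_tree_edge:
  assumes T: "tree T" and v: "v \<in> V" "w \<in> V" "v \<noteq> w"
  obtains h where "h \<in> T" "\<not> conn (T - {h}) v w"
proof -
  have walk: "(v, w) \<in> adj_rel T ends ^^ tdist T v w" using tdist_relpow tree_conn[OF T v(1,2)] .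
  obtain n where n: "tdist T v w = Suc n" using walk v(3) by (cases "tdist T v w") auto
  obtain u where u: "(v, u) \<in> adj_rel T ends ^^ n" "(u, w) \<in> adj_rel T ends"
    using walk n by auto
  obtain k where k: "k \<in> T" "(u, k) \<in> D" "w = opp k u" using u(2) adj_iff[OF tree_E[OF T]] by blast
  have wk: "(w, k) \<in> D" "w \<noteq> u" using k opp_dart opp_neq by auto
  have "\<not> (\<exists>m<n. (v, w) \<in> adj_rel T ends ^^ m)" using tdist_le[where F=T and u=v and w=w] n by fastforce
  then have "conn (T - {k}) v u" using walk_through[OF tree_E[OF T] wk(1) u(1) wk(2)] by blast
  moreover have "\<not> conn (T - {k}) u w" using tree_bridge[OF T k(1,2)] k(3) by simp
  ultimately have "\<not> conn (T - {k}) v w" by (meson conn_sym rtrancl_trans)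
  then show thesis using that k(1) by blast
qed

lemma ex_tree: "\<exists>T. tree T"
proof -
  \<comment> \<open>Induction on the size \<open>n\<close> of a partial tree;
    \<open>inside T S = T\<close> keeps \<open>T\<close> within \<open>S\<close>, so an edge leaving
    \<open>S\<close> is new.\<close>
  have "\<exists>S T. S \<subseteq> V \<and> card S = Suc n \<and> T \<subseteq> E \<and> card T = n \<and> inside T S = T \<and>
      (\<forall>u\<in>S. \<forall>w\<in>S. conn T u w)" if "n < card V" for n
    using that
  proof (induction n)
    case 0
    obtain v where "v \<in> V" using V_nonempty by blast
    then show ?case by (intro exI[of _ "{v}"] exI[of _ "{}"]) (auto simp: inside_def)
  next
    case (Suc n)
    then obtain S T where S: "S \<subseteq> V" "card S = Suc n" "T \<subseteq> E" "card T = n" "inside T S = T"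
      "\<And>u w. u \<in> S \<Longrightarrow> w \<in> S \<Longrightarrow> conn T u w" by (metis Suc_lessD)
    obtain u where u: "u \<in> S" using S(2) by force
    obtain w where w: "w \<in> V" "w \<notin> S" using S(1,2) Suc.prems by (metis less_irrefl subsetI subset_antisym)
    obtain f x where f: "f \<in> E" "(x, f) \<in> D" "x \<in> S" "opp f x \<notin> S"
      using conn_leaves[OF subset_refl u w(2)] connected w u S(1) unfolding connected_on_def by blast
    let ?S = "insert (opp f x) S" and ?T = "insert f T"
    have E: "?T \<subseteq> E" using S(3) f(1) by simp
    have xf: "conn ?T x (opp f x)" using conn_edge[OF E, of f x] f by simp
    have mono: "conn ?T a b" if "a \<in> S" "b \<in> S" for a b
      using conn_mono[of T ?T] S(6)[OF that] by blast
    have tox: "conn ?T a x" if "a \<in> ?S" for a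
      using that mono[of a x] f(3) conn_sym[OF xf] by auto
    have "conn ?T a b" if "a \<in> ?S" "b \<in> ?S" for a b
      using tox[OF that(1)] conn_sym[OF tox[OF that(2)]] by (rule rtrancl_trans)
    moreover have "f \<notin> T"
      using f S(5) by (auto simp: inside_def dart_iff incident_def other_def split: if_splits)
    then have "card ?T = Suc n" using S(3,4) finite_E finite_subset by (metis card_insert_disjoint)
    moreover have "card ?S = Suc (Suc n)"
      using S(1,2) f(4) finite_V finite_subset by (metis card_insert_disjoint)
    moreover have "?S \<subseteq> V" using S(1) opp_dart[OF f(2)] dart_V by blast
    moreover have "inside ?T ?S = ?T"
      using S(5) f(2,3) by (fastforce simp: inside_def dart_iff incident_def other_def split: if_splits)
    ultimately show ?case using E by blast
  qed
  moreover have pos: "card V > 0" using V_nonempty finite_V card_gt_0_iff by blast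
  then have "card V - 1 < card V" "Suc (card V - 1) = card V" by linarith+
  ultimately obtain S T where S: "S \<subseteq> V" "card S = card V" "T \<subseteq> E"
    "card T = card V - 1" "\<forall>u\<in>S. \<forall>w\<in>S. conn T u w"
    by metis
  then have "S = V" using finite_V card_subset_eq by blast
  then have "tree T" using S pos by (auto simp: spanning_tree_def connected_on_def)
  then show ?thesis ..
qed

text \<open>Converse of \<open>rel_conn\<close> for forests. Without edges the orbits are the
  rotations at the vertices; each further edge joins two components and merges their orbits. For F =
  T the tour becomes a single cycle.\<close>

lemma forest_rel:
  assumes T: "tree T" and F: "F \<subseteq> T" and d: "d \<in> D" "d' \<in> D" "conn F (fst d) (fst d')"
  shows "rel F d d'"
proof -
  have "finite F" using F finite_tree[OF T] finite_subset by blast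
  then show ?thesis using F d
  proof (induction F arbitrary: d d' rule: finite_induct)
    case empty
    have "fst d' = fst d" using empty(4)
      by (induction rule: rtrancl_induct) (auto simp: adj_rel_def)
    moreover have "rel {} (u, e) (u, rot u e)" for u e
      using same_orbit_step[of "step {}" "(u, e)"] by (simp add: step_simps)
    then have "rel {} (u, e) (u, e')" if "(u, e) \<in> D" "(u, e') \<in> D" for u e e'
      using rel_vertex that by blast
    ultimately show ?case using empty(2,3) by (metis prod.collapse)
  next
    case (insert f F)
    have E: "T \<subseteq> E" "F \<subseteq> E" "insert f F \<subseteq> E" using tree_E[OF T] insert(4) by auto
    obtain x where x: "(x, f) \<in> D" using insert(4) E edge_dart by blast
    have "\<not> conn F x (opp f x)"
      using tree_bridge[OF T _ x] insert(2,4) conn_mono[of F "T - {f}"] by blast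
    then have sep: "\<not> rel F (x, f) (opp f x, f)" using rel_conn[OF E(2) x] by fastforce
    note m = rel_insert_merge[OF x insert(2) sep]
    have IH: "rel (insert f F) a b" if "a \<in> D" "b \<in> D" "conn F (fst a) (fst b)" for a b
      using m[OF that(1), of b] insert(3)[OF _ that] insert(4) by blast
    have key: "rel (insert f F) d d'"
      if "conn (insert f F) u w" "fst d = u" "fst d' = w" "d \<in> D" "d' \<in> D" for u w d d'
      using that
    proof (induction arbitrary: d' rule: rtrancl_induct)
      case base
      then show ?case using IH[of d d'] by simp
    next
      case (step y z)
      obtain k where k: "k \<in> insert f F" "(y, k) \<in> D" "z = opp k y"
        using step(2) adj_iff[OF E(3)] by blast
      have 1: "rel (insert f F) d (y, k)" using step k by simp
      have 2: "rel (insert f F) (y, k) (z, k)"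
      proof (cases "k = f")
        case True
        then have "(y = x \<or> y = opp f x) \<and> (z = x \<or> z = opp f x)"
          using k dart_cases[OF x] opp_opp[OF x] by auto
        then show ?thesis using m[OF k(2), of "(z, k)"] True by auto
      next
        case False
        then show ?thesis using IH[of "(y, k)" "(z, k)"] k opp_dart conn_edge[OF E(2), of k y] by auto
      qed
      have 3: "rel (insert f F) (z, k) d'"
        using IH[of "(z, k)" d'] k opp_dart step by auto
      show ?case using 1 2 3 by (meson same_orbit_trans)
    qed
    show ?case by (rule key[OF insert(7) refl refl insert(5,6)])
  qed
qed

lemma tree_rel: "tree T \<Longrightarrow> d \<in> D \<Longrightarrow> d' \<in> D \<Longrightarrow> rel T d d'"
  using forest_rel[of T T d d'] tree_conn dart_V by (metis order_refl prod.collapse)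

section \<open>Interlacement, and its existence in positive genus\<close>

section \<open>Interlaced pairs of non-tree edges\<close>

text \<open>The tour of \<open>T\<close> is one cycle, and \<open>e\<close> cuts it into two, one
  through each dart of \<open>e\<close>: the two sides of its fundamental cycle.\<close>

lemma rel_split_classes:
  assumes "tree T" "(v, e) \<in> D" "e \<notin> T" "d \<in> D"
  shows "rel (insert e T) (v, e) d \<or> rel (insert e T) (opp e v, e) d"
  using rel_insert_split[OF assms(2,3) tree_rel[OF assms(1,2) opp_dart[OF assms(2)]] assms(4), of "(v, e)"]
    tree_rel[OF assms(1,4,2)] rel_sym[OF assms(4), of "insert e T" "(v, e)"] by blast

lemma rel_split_separated:
  assumes "tree T" "(v, e) \<in> D" "e \<notin> T"
  shows "\<not> rel (insert e T) (v, e) (opp e v, e)"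
  using rel_insert_separated[OF assms(2,3) tree_rel[OF assms(1,2) opp_dart[OF assms(2)]]] .

text \<open>The orbit condition depends only on the edge set T + e + f, which makes symmetry and the
  behaviour under exchange (\<open>interlaced_exchange\<close>) immediate.\<close>

definition interlaced :: "'e set \<Rightarrow> 'e \<Rightarrow> 'e \<Rightarrow> bool" where
  "interlaced T e f \<longleftrightarrow> e \<in> E \<and> f \<in> E \<and> e \<notin> T \<and> f \<notin> T \<and> e \<noteq> f \<and>
     (\<forall>d\<in>D. \<forall>d'\<in>D. rel (insert e (insert f T)) d d')"

lemma interlaced_sym: "interlaced T e f \<Longrightarrow> interlaced T f e"
  unfolding interlaced_def by (auto simp: insert_commute)

lemma interlaced_exchange:
  assumes "tree T" "h \<in> T" "interlaced T e f"
  shows "interlaced (insert e (T - {h})) h f"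
proof -
  have "insert h (insert f (insert e (T - {h}))) = insert e (insert f T)" using assms(2) by blast
  then show ?thesis using assms tree_E[OF assms(1)] unfolding interlaced_def by auto
qed

text \<open>Adding \<open>f\<close> merges the two orbits of T + e if its darts lie in different
  ones, and splits an orbit otherwise.\<close>

lemma interlaced_iff:
  assumes T: "tree T" and e: "e \<in> E" "e \<notin> T" and f: "(x, f) \<in> D" "f \<notin> T" "e \<noteq> f"
  shows "interlaced T e f \<longleftrightarrow> \<not> rel (insert e T) (x, f) (opp f x, f)"
proof -
  let ?F = "insert e T"
  have nf: "f \<notin> ?F" using f by auto
  have xf: "(opp f x, f) \<in> D" using opp_dart f by blast
  obtain v where v: "(v, e) \<in> D" using edge_dart e by blast
  have c: "insert e (insert f T) = insert f ?F" by auto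
  show ?thesis
  proof
    assume "interlaced T e f"
    then have "rel (insert f ?F) (x, f) (opp f x, f)"
      using f(1) xf unfolding interlaced_def c by blast
    then show "\<not> rel ?F (x, f) (opp f x, f)" using rel_insert_separated[OF f(1) nf] by blast
  next
    assume sep: "\<not> rel ?F (x, f) (opp f x, f)"
    have any: "rel ?F (x, f) d \<or> rel ?F (opp f x, f) d" if d: "d \<in> D" for d
    proof -
      note cl = rel_split_classes[OF T v e(2)]
      have tr: "rel ?F a b" if "rel ?F y a" "rel ?F y b" "y \<in> D" for y a b
        using that rel_sym same_orbit_trans by metis
      show ?thesis
        using cl[OF d] cl[OF f(1)] cl[OF xf] sep tr[OF _ _ v] tr[OF _ _ opp_dart[OF v]] by blast
    qed
    have "rel (insert f ?F) d d'" if "d \<in> D" "d' \<in> D" for d d'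
      using rel_insert_merge[OF f(1) nf sep that(1), of d'] any that by blast
    then show "interlaced T e f"
      using e f dart_E unfolding interlaced_def c by blast
  qed
qed

text \<open>Turning from \<open>h\<close> to the next edge changes the side of \<open>e\<close> only
  if \<open>h\<close> is \<open>e\<close> or lies on the fundamental cycle of \<open>e\<close>. A
  tree edge \<open>h\<close> off that cycle is a bridge of T + e; inserting it last only merges
  orbits and so preserves the plain rotation past \<open>h\<close>.\<close>

lemma rel_corner:
  assumes T: "tree T" and e: "(v, e) \<in> D" "e \<notin> T" and h: "(w, h) \<in> D" "h \<noteq> e"
    and c: "h \<in> T \<Longrightarrow> conn (T - {h}) v (opp e v)"
  shows "rel (insert e T) (w, h) (w, rot w h)"
proof (cases "h \<in> T")
  case False
  then show ?thesis using same_orbit_step[of "step (insert e T)" "(w, h)"] h(2) by (simp add: step_simps)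
next
  case True
  let ?F = "T - {h}" and ?G = "insert e (T - {h})"
  have F: "?F \<subseteq> E" using tree_E[OF T] by blast
  have "rel ?F (v, e) (opp e v, e)"
    using forest_rel[OF T, of ?F "(v, e)" "(opp e v, e)"] e opp_dart c True by auto
  \<comment> \<open>Both ends of \<open>e\<close> lie in one component of T - h, so adding
    \<open>e\<close> splits an orbit.\<close>
  then have finer: "rel ?F a b" if "a \<in> D" "rel ?G a b" for a b
    using rel_insert_split[OF e(1), of ?F a b] that e(2) by blast
  have "\<not> rel ?F (w, h) (opp h w, h)"
    using tree_bridge[OF T True h(1)] rel_conn[OF F h(1)] by fastforce
  then have sep: "\<not> rel ?G (w, h) (opp h w, h)" using finer h by blast
  have "rel ?G (w, h) (w, rot w h)"
    using same_orbit_step[of "step ?G" "(w, h)"] h(2) by (simp add: step_simps)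
  then have "rel (insert h ?G) (w, h) (w, rot w h)"
    using rel_insert_merge[OF h(1) _ sep h(1)] h(2) by blast
  moreover have "insert h ?G = insert e T" using True by blast
  ultimately show ?thesis by simp
qed

section \<open>A non-planar ribbon graph has an interlaced pair\<close>

text \<open>Adding such an edge merges two orbits and so lowers their number; by
  \<open>separatedD\<close> the choice of the end is immaterial.\<close>

definition separated :: "'e set \<Rightarrow> 'e \<Rightarrow> bool" where
  "separated F f \<longleftrightarrow> f \<notin> F \<and> (\<exists>x. (x, f) \<in> D \<and> \<not> rel F (x, f) (opp f x, f))"

lemma separatedD:
  assumes "separated F f" "(y, f) \<in> D"
  shows "\<not> rel F (y, f) (opp f y, f)"
proof -
  obtain x where x: "(x, f) \<in> D" "\<not> rel F (x, f) (opp f x, f)"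
    using assms(1) by (auto simp: separated_def)
  have "y = x \<or> y = opp f x" using dart_cases[OF x(1)] assms(2) by simp
  then show ?thesis using x rel_sym opp_dart opp_opp by metis
qed

definition orbit_rel :: "'e set \<Rightarrow> (('v \<times> 'e) \<times> ('v \<times> 'e)) set" where
  "orbit_rel F = {(d, d'). d \<in> D \<and> d' \<in> D \<and> rel F d d'}"

lemma equiv_orbit_rel: "equiv D (orbit_rel F)"
  unfolding orbit_rel_def using finite_perm.equiv_same_orbit[OF finite_perm_step] .

lemma num_faces_eq: "num_faces E ends rot = card (D // orbit_rel E)"
proof -
  have step: "face_perm ends rot d = step E d" if "d \<in> D" for d
    using that dart_E[of "fst d" "snd d"] by (simp add: face_perm_def bernardi_step_def Let_def)
  have "(face_perm ends rot ^^ n) d = (step E ^^ n) d" if "d \<in> D" for d n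
  proof (induction n)
    case (Suc n)
    then show ?case
      using step finite_perm.funpow_in[OF finite_perm_step that, of n E] by simp
  qed simp
  then have "{(d, d'). d \<in> D \<and> d' \<in> D \<and> (\<exists>n. (face_perm ends rot ^^ n) d = d')} = orbit_rel E"
    by (auto simp: orbit_rel_def same_orbit_def)
  then show ?thesis by (simp add: num_faces_def)
qed

lemma card_orbits_insert:
  assumes f: "(x, f) \<in> D" "f \<notin> F" and r: "rel F (x, f) (opp f x, f)"
  shows "card (D // orbit_rel (insert f F)) = Suc (card (D // orbit_rel F))"
proof (rule card_quotient_merge[OF finite_D equiv_orbit_rel f(1) opp_dart[OF f(1)]])
  show "((x, f), (opp f x, f)) \<notin> orbit_rel (insert f F)"
    using rel_insert_separated[OF f r] by (simp add: orbit_rel_def)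
  fix d d'
  show "(d, d') \<in> orbit_rel F \<longleftrightarrow> (d, d') \<in> orbit_rel (insert f F) \<or>
    (d \<in> orbit_rel (insert f F) `` {(x, f)} \<union> orbit_rel (insert f F) `` {(opp f x, f)} \<and>
     d' \<in> orbit_rel (insert f F) `` {(x, f)} \<union> orbit_rel (insert f F) `` {(opp f x, f)})"
    using rel_insert_split[OF f r, of d d'] opp_dart[OF f(1)] f(1)
    by (auto simp: orbit_rel_def)
qed (rule equiv_orbit_rel)

text \<open>If each edge outside \<open>T\<close> split an orbit when added, the single orbit of
  \<open>T\<close> would turn into 1 + |E - T| faces, which gives Euler characteristic 2.\<close>

lemma nonplanar_separated:
  assumes T: "tree T" and np: "\<not> planar_ribbon V E ends rot"
  obtains F f where "T \<subseteq> F" "F \<subseteq> E" "separated F f"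
proof (rule ccontr)
  assume no: "\<not> thesis"
  note found = that
  have ns: "\<not> separated F f" if "T \<subseteq> F" "F \<subseteq> E" for F f
    using found[OF that] no by blast
  have count: "card (D // orbit_rel (T \<union> G)) = Suc (card G)" if "finite G" "G \<subseteq> E - T" for G
    using that
  proof (induction G rule: finite_induct)
    case empty
    obtain e u where "(u, e) \<in> D" using E_nonempty edge_dart by blast
    moreover have "orbit_rel T = D \<times> D" using tree_rel[OF T] by (auto simp: orbit_rel_def)
    ultimately have "D // orbit_rel T = {D}" by (auto simp: quotient_def)
    then show ?case by simp
  next
    case (insert f G)
    obtain x where x: "(x, f) \<in> D" using insert edge_dart by blast
    have "f \<notin> T \<union> G" using insert by auto
    moreover from this have "rel (T \<union> G) (x, f) (opp f x, f)"
      using ns[of "T \<union> G" f] x insert tree_E[OF T] by (auto simp: separated_def)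
    ultimately show ?case using card_orbits_insert[OF x, of "T \<union> G"] insert by simp
  qed
  have "T \<union> (E - T) = E" using tree_E[OF T] by blast
  then have "num_faces E ends rot = Suc (card (E - T))"
    using count[of "E - T"] finite_E num_faces_eq by simp
  moreover have "card (E - T) = card E - card T" "card T \<le> card E"
    using tree_E[OF T] finite_E card_mono card_Diff_subset finite_tree[OF T] by auto
  ultimately have "int (card V) - int (card E) + int (num_faces E ends rot) = 2"
    using tree_card[OF T] by simp
  then show False using np by (simp add: planar_ribbon_def)
qed

text \<open>Take a smallest \<open>F\<close> containing \<open>T\<close> that has a separated edge
  \<open>f\<close>. If F = T + e, then \<open>e\<close> and \<open>f\<close> are interlaced. Two
  edges \<open>e\<close>, \<open>h\<close> of \<open>F\<close> outside \<open>T\<close> give a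
  contradiction: in \<open>F\<close> each dart of \<open>f\<close> shares its orbit with a different
  dart of \<open>h\<close>, although without \<open>e\<close> the darts of \<open>f\<close> are
  joined and those of \<open>h\<close> are not.\<close>

lemma ex_interlaced:
  assumes T: "tree T" and np: "\<not> planar_ribbon V E ends rot"
  obtains e f where "interlaced T e f"
proof -
  let ?P = "\<lambda>F. T \<subseteq> F \<and> F \<subseteq> E \<and> (\<exists>f. separated F f)"
  obtain F0 f0 where "T \<subseteq> F0" "F0 \<subseteq> E" "separated F0 f0"
    using nonplanar_separated[OF T np] .
  then have "?P F0" by (intro conjI exI)
  from ex_has_least_nat[of ?P, OF this, of card]
  obtain F where F: "?P F" and min: "\<And>F'. ?P F' \<Longrightarrow> card F \<le> card F'" by auto
  obtain f x where f: "separated F f" and x: "(x, f) \<in> D" using F by (auto simp: separated_def)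
  have finF: "finite F" using F finite_E finite_subset by blast
  have nosep: "\<not> separated F' f'" if "T \<subseteq> F'" "F' \<subseteq> E" "card F' < card F" for F' f'
    using min[of F'] that by fastforce
  have "F \<noteq> T" using separatedD[OF f x] tree_rel[OF T x opp_dart[OF x]] by blast
  then obtain e where e: "e \<in> F" "e \<notin> T" using F by blast
  show thesis
  proof (cases "F = insert e T")
    case True
    have "e \<in> E" "f \<notin> T" "e \<noteq> f" using F e f True by (auto simp: separated_def)
    then have "interlaced T e f"
      using interlaced_iff[OF T _ e(2) x] separatedD[OF f x] True by blast
    then show thesis by (rule that)
  next
    case False
    then obtain h where h: "h \<in> F" "h \<notin> T" "h \<noteq> e" using F e by blast
    obtain y where y: "(y, h) \<in> D" using h F edge_dart by blast
    let ?H = "F - {e, h}"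
    have c1: "F - {e} = insert h ?H" "F - {h} = insert e ?H" using e h by auto

    have sm: "card (F - {e}) < card F" "card (F - {h}) < card F" "card ?H < card F"
      by (rule psubset_card_mono[OF finF]; use e h in blast)+
    have rel_h: "rel ?H (y, h) (opp h y, h)"
      using nosep[of ?H h] F e h y sm by (auto simp: separated_def)
    have sep_h: "\<not> rel (F - {e}) (y, h) (opp h y, h)"
      using rel_insert_separated[OF y _ rel_h] c1 by simp
    obtain z where z: "(z, e) \<in> D" using e F edge_dart by blast
    have rel_e: "rel (F - {e}) (z, e) (opp e z, e)"
      using nosep[of "F - {e}" e] F e z sm by (auto simp: separated_def)
    \<comment> \<open>By minimality \<open>e\<close> splits an orbit of F - e, so the orbits of
      \<open>F\<close> refine those of F - e.\<close>
    have finer: "rel (F - {e}) a b" if "a \<in> D" "rel F a b" for a b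
      using rel_insert_split[OF z _ rel_e that(1), of b] that(2) e by (simp add: insert_absorb)
    have rel_f: "rel (F - {e}) (x, f) (opp f x, f)"
      using nosep[of "F - {e}" f] F e x f sm by (auto simp: separated_def)
    \<comment> \<open>An orbit of \<open>F\<close> without a dart of \<open>h\<close> is not
      affected by the removal of \<open>h\<close>.\<close>
    have meets: "rel F d (y, h) \<or> rel F d (opp h y, h)"
      if d: "d \<in> D" "d' \<in> D" and nd: "\<not> rel F d d'" "rel (F - {h}) d d'" for d d'
    proof (rule ccontr)
      assume no: "\<not> ?thesis"
      have eq: "(step (F - {h}) ^^ n) d = (step F ^^ n) d" for n
      proof (induction n)
        case (Suc n)
        let ?s = "(step F ^^ n) d"
        have "rel F d ?s" by (auto simp: same_orbit_def)
        then have "?s \<noteq> (y, h)" "?s \<noteq> (opp h y, h)" "?s \<in> D" using no rel_in d by metis+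
        then have "snd ?s \<noteq> h" using dart_cases[OF y] by (cases ?s) auto
        then have "step (F - {h}) ?s = step F ?s" by (simp add: bernardi_step_def Let_def)
        then show ?case using Suc by simp
      qed simp
      show False using nd eq by (auto simp: same_orbit_def)
    qed
    have rel_f': "rel (F - {h}) (x, f) (opp f x, f)"
      using nosep[of "F - {h}" f] F h x f sm by (auto simp: separated_def)
    let ?a = "(x, f)" and ?b = "(opp f x, f)" and ?p = "(y, h)" and ?q = "(opp h y, h)"
    have bD: "?b \<in> D" "?q \<in> D" using opp_dart x y by auto
    have nab: "\<not> rel F ?a ?b" using separatedD[OF f x] .
    have nba: "\<not> rel F ?b ?a" using nab rel_sym[OF bD(1)] by blast
    have "(rel F ?a ?p \<or> rel F ?a ?q) \<and> (rel F ?b ?p \<or> rel F ?b ?q)"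
      using meets[OF x bD(1) nab rel_f'] meets[OF bD(1) x nba rel_sym[OF x rel_f']] by blast
    moreover have "\<not> (rel F ?a r \<and> rel F ?b r)" for r
      using nab rel_sym[OF bD(1)] same_orbit_trans by metis
    ultimately have "rel F ?a ?p \<and> rel F ?b ?q \<or> rel F ?a ?q \<and> rel F ?b ?p" by blast
    then have "rel (F - {e}) ?a ?p \<and> rel (F - {e}) ?b ?q \<or> rel (F - {e}) ?a ?q \<and> rel (F - {e}) ?b ?p"
      using finer x bD by blast
    moreover have "\<not> (rel (F - {e}) ?a ?p \<and> rel (F - {e}) ?a ?q)"
      using sep_h rel_sym[OF x, of "F - {e}" ?p] same_orbit_trans[of "step (F - {e})" ?p ?a ?q] by blast
    ultimately show thesis
      using same_orbit_trans[OF rel_f, of ?p] same_orbit_trans[OF rel_f, of ?q] by blast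
  qed
qed

section \<open>The combinatorial contradiction from balanced interlacing\<close>

section \<open>Balanced interlacing is impossible\<close>

text \<open>The edges \<open>h\<close> have their darts on different sides of \<open>e\<close>, so
  by \<open>interlaced_iff\<close> they are interlaced with \<open>e\<close>. Of the equality of
  chip counts in \<open>const_shift_balanced\<close> only this existence statement is kept.\<close>

definition balanced :: bool where
  "balanced \<longleftrightarrow> (\<forall>T v e w. tree T \<longrightarrow> (v, e) \<in> D \<longrightarrow> e \<notin> T \<longrightarrow>
     ((\<exists>h. (w, h) \<in> D \<and> h \<notin> insert e T \<and>
         rel (insert e T) (v, e) (w, h) \<and> \<not> rel (insert e T) (v, e) (opp h w, h)) \<longleftrightarrow>
      (\<exists>h. (w, h) \<in> D \<and> h \<notin> insert e T \<and>
         \<not> rel (insert e T) (v, e) (w, h) \<and> rel (insert e T) (v, e) (opp h w, h))))"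

text \<open>The edge \<open>f\<close> itself leaves \<open>x\<close> on one side of
  \<open>e\<close>, and balance supplies an edge for the other side.\<close>

lemma interlaced_sides:
  assumes bal: balanced and T: "tree T" and ef: "interlaced T e f" and v: "(v, e) \<in> D" and x: "(x, f) \<in> D"
  shows "\<exists>h. (x, h) \<in> D \<and> h \<notin> insert e T \<and>
         rel (insert e T) (v, e) (x, h) \<and> \<not> rel (insert e T) (v, e) (opp h x, h)"
    and "\<exists>h. (x, h) \<in> D \<and> h \<notin> insert e T \<and>
         \<not> rel (insert e T) (v, e) (x, h) \<and> rel (insert e T) (v, e) (opp h x, h)"
proof -
  let ?R = "rel (insert e T)"
  have m: "e \<in> E" "e \<notin> T" "f \<notin> T" "e \<noteq> f" using ef by (auto simp: interlaced_def)
  have sep: "\<not> ?R (x, f) (opp f x, f)" using interlaced_iff[OF T m(1,2) x m(3,4)] ef by blast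
  have xf: "(opp f x, f) \<in> D" using opp_dart x by blast
  note cl = rel_split_classes[OF T v m(2)]
  have tr: "?R a b" if "?R y a" "?R y b" "y \<in> D" for y a b
    using that rel_sym same_orbit_trans by metis
  have "?R (v, e) (x, f) \<longleftrightarrow> \<not> ?R (v, e) (opp f x, f)"
    using cl[OF x] cl[OF xf] sep tr[OF _ _ v] tr[OF _ _ opp_dart[OF v]] by blast
  then have "(\<exists>h. (x, h) \<in> D \<and> h \<notin> insert e T \<and> ?R (v, e) (x, h) \<and> \<not> ?R (v, e) (opp h x, h)) \<or>
      (\<exists>h. (x, h) \<in> D \<and> h \<notin> insert e T \<and> \<not> ?R (v, e) (x, h) \<and> ?R (v, e) (opp h x, h))"
    using x m by blast
  moreover note bal[unfolded balanced_def, rule_format, OF T v m(2), of x]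
  ultimately show "\<exists>h. (x, h) \<in> D \<and> h \<notin> insert e T \<and> ?R (v, e) (x, h) \<and> \<not> ?R (v, e) (opp h x, h)"
    "\<exists>h. (x, h) \<in> D \<and> h \<notin> insert e T \<and> \<not> ?R (v, e) (x, h) \<and> ?R (v, e) (opp h x, h)"
    by blast+
qed

text \<open>If \<open>x\<close> lay off the fundamental cycle of \<open>e\<close>, then by
  \<open>rel_corner\<close> all darts at \<open>x\<close> would be on one side of \<open>e\<close>,
  against \<open>interlaced_sides\<close>.\<close>

lemma interlaced_on_path:
  assumes bal: balanced and T: "tree T" and ef: "interlaced T e f"
    and v: "(v, e) \<in> D" and x: "(x, f) \<in> D" "(x, e) \<notin> D"
  obtains h where "h \<in> T" "(x, h) \<in> D" "\<not> conn (T - {h}) v (opp e v)"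
proof (rule ccontr)
  assume no: "\<not> thesis"
  note found = that
  have c: "conn (T - {h}) v (opp e v)" if "h \<in> T" "(x, h) \<in> D" for h
    using found[OF that] no by blast
  have m: "e \<notin> T" using ef by (auto simp: interlaced_def)
  have step: "rel (insert e T) (x, h) (x, rot x h)" if "(x, h) \<in> D" for h
    using rel_corner[OF T v m that] c[OF _ that] that x(2) by blast
  have "rel (insert e T) (x, h) (x, h')" if "(x, h) \<in> D" "(x, h') \<in> D" for h h'
    using rel_vertex[OF step that] by blast
  then show False
    using interlaced_sides[OF bal T ef v x(1)] same_orbit_trans by metis
qed

text \<open>Descent on the number of turns at \<open>v\<close> from \<open>e\<close> to the tree
  edge \<open>g\<close>. The fundamental cycle of \<open>e\<close> is formed by \<open>e\<close> and
  \<open>g\<close>, so all edges interlaced with \<open>e\<close> are parallel to it; one that comes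
  before \<open>g\<close> in the rotation at \<open>v\<close> replaces \<open>g\<close> in the
  tree.\<close>

lemma interlaced_parallel_tree_edge:
  assumes bal: balanced
  shows "tree T \<Longrightarrow> g \<in> T \<Longrightarrow> (v, g) \<in> D \<Longrightarrow> (v, e) \<in> D \<Longrightarrow> opp g v = opp e v \<Longrightarrow>
    interlaced T e f \<Longrightarrow> False"
proof (induction "LEAST p. (rot v ^^ p) e = g" arbitrary: T g f rule: less_induct)
  case less
  note T = less(2) and g = less(3,4) and v = less(5) and gv = less(6)
  let ?R = "rel (insert e T)" and ?v = "opp e v"
  define p where "p = (LEAST p. (rot v ^^ p) e = g)"
  have p: "(rot v ^^ p) e = g" unfolding p_def
    by (rule LeastI_ex) (rule rot_transitive[OF v g(2)])
  have m: "e \<notin> T" "e \<in> E" using less(7) by (auto simp: interlaced_def)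
  have cg: "conn (T - {k}) v ?v" if "k \<noteq> g" for k
    using conn_edge[of "T - {k}" g v] tree_E[OF T] g that[symmetric] gv by auto
  have par: "(x, e) \<in> D" if kx: "interlaced T e k" "(x, k) \<in> D" for x k
  proof (rule ccontr)
    assume xe: "(x, e) \<notin> D"
    obtain h where h: "h \<in> T" "(x, h) \<in> D" "\<not> conn (T - {h}) v ?v"
      using interlaced_on_path[OF bal T kx(1) v kx(2) xe] .
    then have "h = g" using cg by blast
    then have "x = v \<or> x = ?v" using h(2) dart_cases[OF g(2)] gv by auto
    then show False using xe v opp_dart by blast
  qed
  have ends: "(v, k) \<in> D \<and> opp k v = ?v" if k: "interlaced T e k" for k
  proof -
    obtain x where x: "(x, k) \<in> D" using k edge_dart unfolding interlaced_def by blast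
    have "(x, e) \<in> D" "(opp k x, e) \<in> D" using par[OF k] x opp_dart by auto
    then show ?thesis using dart_cases[OF v] opp_neq[OF x] x opp_dart opp_opp by metis
  qed
  have vf: "(v, f) \<in> D" using ends less(7) by blast
  \<comment> \<open>This \<open>h\<close> starts at \<open>v\<close> on the side of the far dart
    \<open>(?v, e)\<close>, not on that of \<open>(v, e)\<close>.\<close>
  obtain h where h: "(v, h) \<in> D" "h \<notin> insert e T" "?R (?v, e) (v, h)" "\<not> ?R (?v, e) (opp h v, h)"
    using interlaced_sides(1)[OF bal T less(7) opp_dart[OF v] vf] by blast
  have "\<not> ?R (v, h) (opp h v, h)" using h(3,4) same_orbit_trans by metis
  then have eh: "interlaced T e h" using interlaced_iff[OF T m(2,1) h(1)] h(2) by blast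
  have hv: "opp h v = ?v" using ends eh by blast
  define q where "q = (LEAST q. (rot v ^^ q) e = h)"
  have q: "(rot v ^^ q) e = h" unfolding q_def
    by (rule LeastI_ex) (rule rot_transitive[OF v h(1)])
  \<comment> \<open>Otherwise the rotation from \<open>h\<close> on to \<open>e\<close> does not
    pass \<open>g\<close>, and \<open>rel_corner\<close> carries the side of \<open>h\<close> over
    to \<open>(v, e)\<close>. Below, \<open>N\<close> is the length of the rotation cycle at
    \<open>v\<close>.\<close>
  have "q < p"
  proof (rule ccontr)
    assume "\<not> q < p"
    moreover have "q \<noteq> p" using p q h(2) g by auto
    ultimately have pq: "p < q" by simp
    obtain j where j: "(rot v ^^ j) h = e" using rot_transitive[OF h(1) v] by blast
    define N where "N = (LEAST n. 0 < n \<and> (rot v ^^ n) e = e)"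
    have exN: "0 < j + q \<and> (rot v ^^ (j + q)) e = e" using pq j q by (simp add: funpow_add)
    have N: "0 < N" "(rot v ^^ N) e = e"
      unfolding N_def using LeastI[where P="\<lambda>n. 0 < n \<and> (rot v ^^ n) e = e", OF exN] by auto
    have Nle: "N \<le> n" if "0 < n" "(rot v ^^ n) e = e" for n
      unfolding N_def using that by (intro Least_le) simp
    have "q \<le> N"
    proof (rule ccontr)
      assume "\<not> q \<le> N"
      then have "(rot v ^^ (q - N)) e = h" "q - N < q"
        using N q funpow_add[of "q - N" N "rot v"] by auto
      then show False using Least_le[of "\<lambda>q. (rot v ^^ q) e = h" "q - N"] q_def by simp
    qed
    have chain: "?R (v, h) (v, (rot v ^^ i) e)" if "q \<le> i" "i \<le> N" for i
      using that
    proof (induction i rule: dec_induct)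
      case base
      then show ?case using q by simp
    next
      case (step i)
      let ?k = "(rot v ^^ i) e"
      have k1: "?k \<noteq> e" using Nle[of i] step pq by auto
      \<comment> \<open>If \<open>g\<close> occurred again at i with p < q <= i < N, the rotation
        would return to \<open>e\<close> after only N - i + p < N turns.\<close>
      have k2: "?k \<noteq> g"
      proof
        assume kg: "?k = g"
        have "(rot v ^^ (N - i + p)) e = (rot v ^^ (N - i)) ((rot v ^^ i) e)"
          using kg p by (simp add: funpow_add)
        also have "\<dots> = (rot v ^^ N) e"
          using step funpow_add[of "N - i" i "rot v"] by simp
        finally show False using N(2) Nle[of "N - i + p"] step pq by simp
      qed
      have "?R (v, ?k) (v, rot v ?k)"
        by (rule rel_corner[OF T v m(1) rot_funpow_in[OF v] k1]) (use cg[OF k2] in simp)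
      then show ?case using step same_orbit_trans by fastforce
    qed
    have "?R (v, h) (v, e)" using chain[OF \<open>q \<le> N\<close>] N by simp
    then have "?R (?v, e) (v, e)" using h(3) same_orbit_trans by metis
    then show False using rel_split_separated[OF T v m(1)] rel_sym[OF opp_dart[OF v]] by blast
  qed
  have "\<not> conn (T - {g}) v (opp h v)" using tree_bridge[OF T g] gv hv by simp
  then have T': "tree (insert h (T - {g}))" using tree_exchange[OF T g(1) h(1)] h(2) by blast
  \<comment> \<open>With \<open>h\<close> in place of \<open>g\<close> in the tree, \<open>e\<close>
    and \<open>g\<close> are interlaced, and the parallel tree edge is only \<open>q\<close> turns
    away.\<close>
  have "interlaced (insert h (T - {g})) e g"
    using interlaced_sym[OF interlaced_exchange[OF T g(1) interlaced_sym[OF eh]]] .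
  then show False
    using less(1)[OF _ T' _ h(1) v hv] \<open>q < p\<close> unfolding p_def q_def by blast
qed

lemma not_balanced:
  assumes T: "tree T" and ef: "interlaced T e f"
  shows "\<not> balanced"
proof
  assume bal: balanced
  \<comment> \<open>First the two edges are made to share a vertex: if \<open>x\<close> is not an
    end of \<open>e\<close>, a tree edge at \<open>x\<close> on the fundamental cycle of
    \<open>e\<close> takes the place of \<open>e\<close>.\<close>
  have "\<exists>T e f x. tree T \<and> interlaced T e f \<and> (x, e) \<in> D \<and> (x, f) \<in> D"
  proof -
    obtain v x where v: "(v, e) \<in> D" and x: "(x, f) \<in> D"
      using ef edge_dart unfolding interlaced_def by blast
    show ?thesis
    proof (cases "(x, e) \<in> D")
      case True
      then show ?thesis using T ef x by blast
    next
      case False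
      obtain h where h: "h \<in> T" "(x, h) \<in> D" "\<not> conn (T - {h}) v (opp e v)"
        using interlaced_on_path[OF bal T ef v x False] .
      have "e \<notin> T" using ef by (simp add: interlaced_def)
      then show ?thesis
        using tree_exchange[OF T h(1) v _ h(3)] interlaced_exchange[OF T h(1) ef] h(2) x by blast
    qed
  qed
  then obtain T e f x where T: "tree T" and ef: "interlaced T e f" and x: "(x, e) \<in> D" "(x, f) \<in> D"
    by blast
  let ?y = "opp f x" and ?z = "opp e x"
  have V: "x \<in> V" "?y \<in> V" "?z \<in> V" using x opp_dart dart_V by blast+
  have m: "e \<notin> T" "f \<notin> T" using ef by (auto simp: interlaced_def)
  show False
  proof (cases "?y = ?z")
    case True
    \<comment> \<open>For parallel \<open>e\<close> and \<open>f\<close>, exchanging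
      \<open>f\<close> with an edge \<open>h\<close> of its fundamental cycle makes \<open>e\<close>
      parallel to a tree edge and interlaced with \<open>h\<close>.\<close>
    obtain h where h: "h \<in> T" "\<not> conn (T - {h}) x ?y"
      using separating_tree_edge[OF T V(1,2)] opp_neq[OF x(2)] by metis
    have T': "tree (insert f (T - {h}))" using tree_exchange[OF T h(1) x(2) m(2) h(2)] .
    have "interlaced (insert f (T - {h})) e h"
      using interlaced_sym[OF interlaced_exchange[OF T h(1) interlaced_sym[OF ef]]] .
    then show False
      using interlaced_parallel_tree_edge[OF bal T' _ x(2,1) True] by blast
  next
    case False
    \<comment> \<open>The far end of \<open>k\<close> lies on the tree path from \<open>x\<close> to
      the far end of \<open>l\<close>, hence nearer to \<open>x\<close>. Applied both ways this is
      absurd.\<close>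
    have key: "tdist T x (opp k x) < tdist T x (opp l x)"
      if kl: "interlaced T l k" "(x, l) \<in> D" "(x, k) \<in> D" "opp k x \<noteq> opp l x" for k l
    proof -
      have "(opp k x, l) \<notin> D" using dart_cases[OF kl(2)] kl(4) opp_neq[OF kl(3)] by blast
      then obtain h where h: "h \<in> T" "(opp k x, h) \<in> D" "\<not> conn (T - {h}) x (opp l x)"
        using interlaced_on_path[OF bal T kl(1,2) opp_dart[OF kl(3)]] by blast
      have "opp l x \<in> V" using kl opp_dart dart_V by blast
      then show ?thesis
        using tdist_less[OF tree_E[OF T] h(2) tree_conn[OF T V(1)] h(3) kl(4)] by blast
    qed
    show False using key[OF ef x False] key[OF interlaced_sym[OF ef] x(2,1)] False by simp
  qed
qed

section \<open>Bernardi divisors under a change of the starting dart\<close>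

section \<open>Moving the starting point of the tour\<close>

abbreviation bern :: "'e set \<Rightarrow> 'v \<times> 'e \<Rightarrow> 'v \<Rightarrow> int" where
  "bern T d \<equiv> bernardi E ends rot (fst d) (snd d) T"

definition first_visit :: "'e set \<Rightarrow> 'v \<times> 'e \<Rightarrow> 'e \<Rightarrow> nat" where
  "first_visit T d f = (LEAST n. snd ((step T ^^ n) d) = f)"

lemma eta_first_visit: "eta ends rot T (fst d) (snd d) f = fst ((step T ^^ first_visit T d f) d)"
  by (simp add: eta_def tour_def first_visit_def)

lemma tour_in: "d \<in> D \<Longrightarrow> (step T ^^ n) d \<in> D"
  using finite_perm.funpow_in[OF finite_perm_step] .

lemma first_visit:
  assumes "tree T" "d \<in> D" "f \<in> E"
  shows "snd ((step T ^^ first_visit T d f) d) = f"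
proof -
  obtain x where x: "(x, f) \<in> D" using assms edge_dart by blast
  then obtain n where "(step T ^^ n) d = (x, f)"
    using tree_rel[OF assms(1,2) x] by (auto simp: same_orbit_def)
  then have "snd ((step T ^^ n) d) = f" by simp
  then show ?thesis unfolding first_visit_def by (rule LeastI)
qed

lemma first_visit_le: "snd ((step T ^^ n) d) = f \<Longrightarrow> first_visit T d f \<le> n"
  unfolding first_visit_def by (rule Least_le)

lemma eta_dart:
  assumes "tree T" "d \<in> D" "f \<in> E"
  shows "(eta ends rot T (fst d) (snd d) f, f) \<in> D"
  using first_visit[OF assms] tour_in[OF assms(2), of "first_visit T d f" T]
  unfolding eta_first_visit by (metis prod.collapse)

lemma eta_start: "eta ends rot T (fst d) (snd d) (snd d) = fst d"
proof -
  have "first_visit T d (snd d) = 0" using first_visit_le[of 0 T d] by simp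
  then show ?thesis by (simp add: eta_first_visit)
qed

lemma eta_shift:
  assumes "tree T" "d \<in> D" "f \<in> E" "f \<noteq> snd d"
  shows "eta ends rot T (fst (step T d)) (snd (step T d)) f = eta ends rot T (fst d) (snd d) f"
proof -
  have "first_visit T d f = Suc (first_visit T (step T d) f)"
    unfolding first_visit_def
    by (subst Least_Suc[where n="first_visit T d f"])
      (use first_visit[OF assms(1-3)] assms(4) in \<open>simp_all add: funpow_swap1\<close>)
  then show ?thesis by (simp add: eta_first_visit funpow_swap1)
qed

text \<open>From \<open>(v, e)\<close> the tour meets the opposite dart of \<open>e\<close> before
  it returns to \<open>(v, e)\<close>; starting one step later, it cuts \<open>e\<close> first from
  the other end.\<close>

lemma eta_shift_start:
  assumes T: "tree T" and d: "(v, e) \<in> D" and e: "e \<notin> T"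
  shows "eta ends rot T (fst (step T (v, e))) (snd (step T (v, e))) e = opp e v"
proof -
  let ?d = "(v, e)" and ?b = "(opp e v, e)"
  have E: "e \<in> E" using d dart_E by blast
  have b: "?b \<in> D" using d opp_dart by blast
  obtain k where k: "k > 0" "(step T ^^ k) ?d = ?b" "?d \<notin> (\<lambda>i. (step T ^^ i) ?d) ` {1..k}"
    using perm_transpose.split_orbit[OF perm_transpose_step[OF d e] tree_rel[OF T d b]] by metis
  let ?n = "first_visit T (step T ?d) e"
  have sd: "step T ?d \<in> D" using step_in d by blast
  have "(step T ^^ (k - 1)) (step T ?d) = ?b"
    using k(1,2) by (metis Suc_diff_1 funpow_simps_right(2) comp_apply)
  then have "?n \<le> k - 1" by (intro first_visit_le) simp
  then have "Suc ?n \<in> {1..k}" using k(1) by auto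
  then have ne: "(step T ^^ ?n) (step T ?d) \<noteq> ?d"
    using k(3) by (metis (no_types, lifting) comp_apply funpow_simps_right(2) imageI)
  have "(eta ends rot T (fst (step T ?d)) (snd (step T ?d)) e, e) \<in> D"
    using eta_dart[OF T sd E] .
  moreover have "eta ends rot T (fst (step T ?d)) (snd (step T ?d)) e \<noteq> v"
    using ne first_visit[OF T sd E] unfolding eta_first_visit by (metis prod.collapse)
  ultimately show ?thesis using dart_cases[OF d] by blast
qed

text \<open>The divisor of a chip that moves along the dart to the other end of its edge.\<close>

definition chip :: "'v \<times> 'e \<Rightarrow> 'v \<Rightarrow> int" where
  "chip d w = of_bool (w = opp (snd d) (fst d)) - of_bool (w = fst d)"

text \<open>The change of the Bernardi divisor when the start moves past \<open>d\<close>; see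
  \<open>bern_step\<close>.\<close>

definition tree_chip :: "'e set \<Rightarrow> 'v \<times> 'e \<Rightarrow> 'v \<Rightarrow> int" where
  "tree_chip T d w = (if snd d \<in> T then 0 else chip d w)"

lemma card_filter_sum: "finite A \<Longrightarrow> int (card {x \<in> A. P x}) = (\<Sum>x\<in>A. of_bool (P x))"
  by (simp add: of_bool_def sum.If_cases Int_def)

lemma bern_sum: "bern T d w = (\<Sum>f\<in>E - T. of_bool (eta ends rot T (fst d) (snd d) f = w))"
  using finite_E by (simp only: bernardi_def card_filter_sum finite_Diff)

lemma bern_step:
  assumes T: "tree T" and d: "d \<in> D"
  shows "bern T (step T d) w = bern T d w + tree_chip T d w"
proof -
  obtain v e where ve: "d = (v, e)" by (cases d)
  let ?g = "\<lambda>d f. of_bool (eta ends rot T (fst d) (snd d) f = w) :: int"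
  have same: "?g (step T d) f = ?g d f" if "f \<in> E" "f \<noteq> e" for f
    using eta_shift[OF T d that(1)] that(2) ve by simp
  show ?thesis
  proof (cases "e \<in> T")
    case True
    have "(\<Sum>f\<in>E - T. ?g (step T d) f) = (\<Sum>f\<in>E - T. ?g d f)"
      by (rule sum.cong[OF refl], rule same) (use True in auto)
    then show ?thesis using True ve unfolding bern_sum by (simp add: tree_chip_def)
  next
    case False
    have e: "e \<in> E - T" using False d ve dart_E by blast
    have fin: "finite (E - T)" using finite_E by blast
    have rest: "(\<Sum>f\<in>E - T - {e}. ?g (step T d) f) = (\<Sum>f\<in>E - T - {e}. ?g d f)"
      by (rule sum.cong[OF refl], rule same) auto
    have "?g (step T d) e = of_bool (opp e v = w)"
      using eta_shift_start[OF T _ False, of v] d ve by simp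
    moreover have "?g d e = of_bool (v = w)"
      using eta_start[of T d] ve by simp
    ultimately show ?thesis
      using rest False ve unfolding bern_sum sum.remove[OF fin e]
      by (auto simp: tree_chip_def chip_def)
  qed
qed

lemma bern_segment:
  assumes T: "tree T" and d: "d \<in> D"
  shows "bern T ((step T ^^ n) d) w = bern T d w + (\<Sum>i<n. tree_chip T ((step T ^^ i) d) w)"
proof (induction n)
  case (Suc n)
  then show ?case using bern_step[OF T tour_in[OF d, of n T], of w] by simp
qed simp

text \<open>The tour from \<open>a\<close> to just after \<open>b\<close> passes \<open>a\<close>
  and then the arc that \<open>split_orbit\<close> identifies with the \<open>q\<close>-orbit of
  \<open>b\<close>; a sum over tour positions becomes a sum over an orbit.\<close>

lemma bern_across:
  assumes T: "tree T" and pt: "perm_transpose D (step T) q a b"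
  shows "bern T (step T b) w =
    bern T a w + tree_chip T a w + (\<Sum>d\<in>{x. same_orbit q b x}. tree_chip T d w)"
proof -
  interpret perm_transpose D "step T" q a b by (rule pt)
  obtain k where k: "k > 0" "(step T ^^ k) a = b" "inj_on (\<lambda>i. (step T ^^ i) a) {1..k}"
    "{x. same_orbit q b x} = (\<lambda>i. (step T ^^ i) a) ` {1..k}"
    using split_orbit[OF tree_rel[OF T a b]] by metis
  have "{..<Suc k} = insert 0 {1..k}" by auto
  then have "(\<Sum>i<Suc k. tree_chip T ((step T ^^ i) a) w) =
      tree_chip T a w + (\<Sum>i\<in>{1..k}. tree_chip T ((step T ^^ i) a) w)"
    by simp
  also have "(\<Sum>i\<in>{1..k}. tree_chip T ((step T ^^ i) a) w) = (\<Sum>d\<in>{x. same_orbit q b x}. tree_chip T d w)"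
    unfolding k(4) by (subst sum.reindex[OF k(3)]) simp
  finally show ?thesis
    using bern_segment[OF T a, of "Suc k" w] k(2) by simp
qed

section \<open>Uniqueness of break divisors in their classes\<close>

section \<open>Principal divisors and break divisors\<close>

definition principal :: "('v \<Rightarrow> int) \<Rightarrow> bool" where
  "principal Z \<longleftrightarrow> (\<exists>f. \<forall>u. Z u = (if u \<in> V then laplacian E ends f u else 0))"

lemma lin_equiv_iff: "lin_equiv V E ends A B \<longleftrightarrow> principal (\<lambda>u. A u - B u)"
  by (simp add: lin_equiv_def principal_def)

lemma principal_zero: "principal (\<lambda>u. 0)"
  unfolding principal_def by (rule exI[of _ "\<lambda>_. 0"]) (simp add: laplacian_def)

lemma principal_add: "principal A \<Longrightarrow> principal B \<Longrightarrow> principal (\<lambda>u. A u + B u)"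
  unfolding principal_def
proof (elim exE)
  fix f g
  assume "\<forall>u. A u = (if u \<in> V then laplacian E ends f u else 0)"
    "\<forall>u. B u = (if u \<in> V then laplacian E ends g u else 0)"
  then show "\<exists>f. \<forall>u. A u + B u = (if u \<in> V then laplacian E ends f u else 0)"
    by (intro exI[of _ "\<lambda>u. f u + g u"])
      (simp add: laplacian_def sum.distrib[symmetric] algebra_simps)
qed

lemma principal_minus: "principal A \<Longrightarrow> principal (\<lambda>u. - A u)"
  unfolding principal_def
proof (elim exE)
  fix f
  assume "\<forall>u. A u = (if u \<in> V then laplacian E ends f u else 0)"
  then show "\<exists>f. \<forall>u. - A u = (if u \<in> V then laplacian E ends f u else 0)"
    by (intro exI[of _ "\<lambda>u. - f u"]) (simp add: laplacian_def sum_negf[symmetric])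
qed

lemma principal_diff: "principal A \<Longrightarrow> principal B \<Longrightarrow> principal (\<lambda>u. A u - B u)"
  using principal_add[OF _ principal_minus] by fastforce

lemma sum_card_fibres:
  assumes "finite A" "finite S"
  shows "(\<Sum>w\<in>S. int (card {f \<in> A. c f = w})) = int (card {f \<in> A. c f \<in> S})"
proof -
  have "{f \<in> A. c f \<in> S} = (\<Union>w\<in>S. {f \<in> A. c f = w})" by auto
  moreover have "card (\<Union>w\<in>S. {f \<in> A. c f = w}) = (\<Sum>w\<in>S. card {f \<in> A. c f = w})"
    using assms by (intro card_UN_disjoint) auto
  ultimately show ?thesis by simp
qed

lemma bern_break:
  assumes "tree T" "d \<in> D"
  shows "bern T d \<in> break_divs V E ends"
  unfolding break_divs_def bernardi_def
  using assms eta_dart[OF assms] by (auto simp: dart_iff intro!: exI[of _ T])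

lemma break_outside:
  assumes B: "B \<in> break_divs V E ends" and w: "w \<notin> V"
  shows "B w = 0"
proof -
  obtain T c where c: "\<And>f. f \<in> E - T \<Longrightarrow> incident ends f (c f)" "B = (\<lambda>w. int (card {f \<in> E - T. c f = w}))"
    using B by (auto simp: break_divs_def)
  have "c f \<in> V" if "f \<in> E - T" for f using c(1)[OF that] that dart_V[of "c f" f] by (simp add: dart_iff)
  then have "{f \<in> E - T. c f = w} = {}" using w by blast
  then show ?thesis unfolding c(2) by (metis card.empty of_nat_0)
qed

lemma card_inside_diff:
  assumes "F \<subseteq> E"
  shows "card (inside E S - F) + card (inside F S) = card (inside E S)"
proof -
  have "inside E S - F = inside E S - inside F S" "inside F S \<subseteq> inside E S"
    using assms by (auto simp: inside_def)
  moreover have "finite (inside E S)" using finite_E by (simp add: inside_def)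
  ultimately show ?thesis
    by (metis card_Diff_subset card_mono finite_subset le_add_diff_inverse2)
qed

text \<open>Every edge inside \<open>S\<close> but outside \<open>T\<close> has its chip in
  \<open>S\<close>, and \<open>T\<close> has at most |S| - 1 edges inside \<open>S\<close>.\<close>

lemma break_lower:
  assumes B: "B \<in> break_divs V E ends" and S: "S \<subseteq> V" "S \<noteq> {}"
  shows "sum B S \<ge> int (card (inside E S)) - int (card S) + 1"
proof -
  obtain T c where T: "tree T" and c: "\<And>f. f \<in> E - T \<Longrightarrow> incident ends f (c f)"
    "B = (\<lambda>w. int (card {f \<in> E - T. c f = w}))"
    using B by (auto simp: break_divs_def)
  have "sum B S = int (card {f \<in> E - T. c f \<in> S})"
    unfolding c(2) using finite_E finite_subset[OF S(1) finite_V] by (intro sum_card_fibres) auto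
  moreover have "c f \<in> S" if "f \<in> inside E S - T" for f
    using c(1)[of f] that by (auto simp: inside_def incident_def)
  then have "card (inside E S - T) \<le> card {f \<in> E - T. c f \<in> S}"
    using finite_E by (intro card_mono) (auto simp: inside_def)
  moreover note card_inside_diff[OF tree_E[OF T], of S] card_inside_tree[OF T S]
  ultimately show ?thesis by linarith
qed

lemma break_total:
  assumes B: "B \<in> break_divs V E ends"
  shows "sum B V = int (card E) - int (card V) + 1"
proof -
  obtain T c where T: "tree T" and c: "\<And>f. f \<in> E - T \<Longrightarrow> incident ends f (c f)"
    "B = (\<lambda>w. int (card {f \<in> E - T. c f = w}))"
    using B by (auto simp: break_divs_def)
  have "sum B V = int (card {f \<in> E - T. c f \<in> V})"
    unfolding c(2) using finite_E finite_V by (intro sum_card_fibres) auto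
  also have "{f \<in> E - T. c f \<in> V} = E - T"
    using c(1) dart_V by (auto simp: dart_iff)
  finally have "sum B V = int (card (E - T))" .
  moreover have "card (E - T) = card E - card T" "card T \<le> card E"
    using tree_E[OF T] finite_E card_mono card_Diff_subset finite_tree[OF T] by auto
  ultimately show ?thesis using tree_card[OF T] by simp
qed

definition crossing :: "'v set \<Rightarrow> 'e set" where
  "crossing S = {e \<in> E. fst (ends e) \<in> S \<longleftrightarrow> snd (ends e) \<notin> S}"

lemma card_crossing: "S \<subseteq> V \<Longrightarrow>
  card E = card (inside E S) + card (inside E (V - S)) + card (crossing S)"
proof -
  assume S: "S \<subseteq> V"
  have fin: "finite (inside E X)" "finite (crossing X)" for X
    using finite_E by (auto simp: inside_def crossing_def)
  have "E = (inside E S \<union> inside E (V - S)) \<union> crossing S"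
    using ends_V by (auto simp: inside_def crossing_def)
  moreover have "(inside E S \<union> inside E (V - S)) \<inter> crossing S = {}" "inside E S \<inter> inside E (V - S) = {}"
    by (auto simp: inside_def crossing_def)
  ultimately show ?thesis using fin card_Un_disjoint by (metis finite_UnI)
qed

lemma crossing_dart:
  assumes "h \<in> crossing S"
  obtains x where "(x, h) \<in> D" "x \<in> S" "opp h x \<notin> S"
  using assms that[of "fst (ends h)"] that[of "snd (ends h)"]
  by (auto simp: crossing_def dart_iff incident_def other_def split: if_splits)

text \<open>Firing the set where f is maximal already moves too many chips out of it.\<close>

lemma break_unique:
  assumes B: "B \<in> break_divs V E ends" "B' \<in> break_divs V E ends"
    and eq: "principal (\<lambda>u. B u - B' u)"
  shows "B = B'"
proof (rule ccontr)
  assume ne: "B \<noteq> B'"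
  obtain f where f: "\<And>u. B u - B' u = (if u \<in> V then laplacian E ends f u else 0)"
    using eq by (auto simp: principal_def)
  define M where "M = Max (f ` V)"
  define S where "S = {u \<in> V. f u = M}"
  have fM: "f u \<le> M" if "u \<in> V" for u unfolding M_def using that finite_V by simp
  have "M \<in> f ` V" unfolding M_def using finite_V V_nonempty by simp
  then have S: "S \<subseteq> V" "S \<noteq> {}" by (auto simp: S_def)
  have finS: "finite S" using S finite_V finite_subset by blast
  have "V - S \<noteq> {}"
  proof
    assume "V - S = {}"
    then have const: "f u = M" if "u \<in> V" for u using that by (auto simp: S_def)
    have "laplacian E ends f u = 0" if "u \<in> V" for u
      unfolding laplacian_def edges_at_eq
      by (rule sum.neutral) (use const that opp_dart dart_V in force)
    then have "B u = B' u" for u using f[of u] by (cases "u \<in> V") auto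
    then show False using ne by blast
  qed
  have "sum B S - sum B' S = (\<Sum>u\<in>S. \<Sum>e\<in>edges_at E ends u. f u - f (opp e u))"
    unfolding sum_subtractf[symmetric] using S(1) f by (intro sum.cong) (auto simp: laplacian_def)
  also have "\<dots> \<ge> (\<Sum>u\<in>S. \<Sum>e\<in>edges_at E ends u. of_bool (opp e u \<notin> S))"
  proof (intro sum_mono)
    fix u e assume "u \<in> S" "e \<in> edges_at E ends u"
    then have "opp e u \<in> V" "f u = M" using opp_dart dart_V by (auto simp: edges_at_eq S_def)
    then show "of_bool (opp e u \<notin> S) \<le> f u - f (opp e u)"
      using fM[of "opp e u"] by (auto simp: S_def)
  qed
  also have "(\<Sum>u\<in>S. \<Sum>e\<in>edges_at E ends u. of_bool (opp e u \<notin> S) :: int) =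
      int (card {d \<in> Sigma S (edges_at E ends). opp (snd d) (fst d) \<notin> S})"
  proof -
    have fe: "finite (edges_at E ends u)" for u using finite_E by (simp add: edges_at_def)
    have "(\<Sum>u\<in>S. \<Sum>e\<in>edges_at E ends u. of_bool (opp e u \<notin> S) :: int) =
        (\<Sum>d\<in>Sigma S (edges_at E ends). of_bool (opp (snd d) (fst d) \<notin> S))"
      by (subst sum.Sigma) (use fe finS in \<open>auto simp: split_def\<close>)
    then show ?thesis
      by (subst card_filter_sum) (use fe finS in auto)
  qed
  finally have "sum B S - sum B' S \<ge> int (card {d \<in> Sigma S (edges_at E ends). opp (snd d) (fst d) \<notin> S})" .
  moreover have "card (crossing S) \<le> card {d \<in> Sigma S (edges_at E ends). opp (snd d) (fst d) \<notin> S}"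
  proof -
    let ?X = "{d \<in> Sigma S (edges_at E ends). opp (snd d) (fst d) \<notin> S}"
    have "?X \<subseteq> D" by (auto simp: edges_at_eq)
    then have "finite ?X" using finite_D finite_subset by blast
    moreover have "crossing S \<subseteq> snd ` ?X"
    proof
      fix h assume "h \<in> crossing S"
      then obtain x where "(x, h) \<in> D" "x \<in> S" "opp h x \<notin> S" by (rule crossing_dart)
      then show "h \<in> snd ` ?X" by (intro image_eqI[of _ _ "(x, h)"]) (auto simp: edges_at_eq)
    qed
    ultimately show ?thesis by (rule surj_card_le)
  qed
  moreover have "sum B V = sum B S + sum B (V - S)"
    using sum.subset_diff[OF S(1) finite_V, of B] by simp
  moreover have "card V = card S + card (V - S)"
    using S finS finite_V card_mono[OF finite_V S(1)] by (simp add: card_Diff_subset)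
  \<comment> \<open>The bounds for \<open>B'\<close> on \<open>S\<close> and for \<open>B\<close> on
    V - S, with the total degree of \<open>B\<close>, make B(S) - B'(S) smaller than the number of
    edges leaving \<open>S\<close>; the Laplacian makes it at least that number.\<close>
  moreover note break_lower[OF B(2) S] break_lower[OF B(1) _ \<open>V - S \<noteq> {}\<close>] break_total[OF B(1)]
    card_crossing[OF S(1)]
  ultimately show False by simp
qed

section \<open>Recovering the tree from its Bernardi divisor\<close>

section \<open>Injectivity of the Bernardi map\<close>

lemma tour_cong:
  assumes "\<And>j. j < i \<Longrightarrow> snd ((step T ^^ j) d) \<in> T \<longleftrightarrow> snd ((step T ^^ j) d) \<in> T'"
  shows "(step T' ^^ i) d = (step T ^^ i) d"
  using assms
proof (induction i)
  case (Suc i)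
  have "step T' s = step T s" if "snd s \<in> T \<longleftrightarrow> snd s \<in> T'" for s
    using that by (simp add: bernardi_step_def Let_def)
  then show ?case using Suc by simp
qed simp

text \<open>The tours agree until time \<open>n\<close>, when \<open>T\<close> walks along an edge f
  from a vertex u and \<open>T'\<close> cuts it there. On the component S of u in T - f,
  \<open>T'\<close> places more chips: it has no more edges inside S than \<open>T\<close>, keeps
  the chips that \<open>T\<close> puts on S from edges leaving S, and adds the chip of f at
  u.\<close>

lemma bern_differs:
  assumes T: "tree T" and T': "tree T'" and d: "d \<in> D"
    and agree: "\<And>i. i < n \<Longrightarrow> snd ((step T ^^ i) d) \<in> T \<longleftrightarrow> snd ((step T ^^ i) d) \<in> T'"
    and f: "snd ((step T ^^ n) d) \<in> T" "snd ((step T ^^ n) d) \<notin> T'"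
  shows "bern T d \<noteq> bern T' d"
proof
  assume eq: "bern T d = bern T' d"
  obtain u f where uf: "(step T ^^ n) d = (u, f)" by (cases "(step T ^^ n) d")
  have ufD: "(u, f) \<in> D" using tour_in[OF d, of n T] uf by simp
  have fT: "f \<in> T" "f \<notin> T'" "f \<in> E" using f uf ufD dart_E by auto
  let ?F = "T - {f}" and ?eta = "\<lambda>T h. eta ends rot T (fst d) (snd d) h"
  have FE: "?F \<subseteq> E" using tree_E[OF T] by blast
  have same: "(step T' ^^ i) d = (step T ^^ i) d" if "i \<le> n" for i
    using tour_cong[of i T d T'] agree that by simp
  define S where "S = {w \<in> V. conn ?F u w}"
  have uV: "u \<in> V" "opp f u \<in> V" using ufD opp_dart dart_V by blast+
  have bridge: "\<not> conn ?F u (opp f u)" using tree_bridge[OF T fT(1) ufD] .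
  have S: "S \<subseteq> V" "u \<in> S" "opp f u \<notin> S" using uV bridge by (auto simp: S_def)
  have other: "conn ?F (opp f u) w" if "w \<in> V - S" for w
    using conn_remove[OF tree_E[OF T] ufD tree_conn[OF T uV(1), of w]] that bridge
    by (auto simp: S_def)
  have nS: "w \<notin> S" if "conn ?F (opp f u) w" for w
  proof
    assume "w \<in> S"
    then have "conn ?F u w" by (simp add: S_def)
    then show False using bridge rtrancl_trans[OF _ conn_sym[OF that]] by blast
  qed
  have pt: "perm_transpose D (step T) (step ?F) (u, f) (opp f u, f)"
    using perm_transpose_sym[OF perm_transpose_step[OF ufD, of ?F]] fT(1) by (simp add: insert_absorb)
  obtain k where k: "{x. rel ?F (opp f u, f) x} = (\<lambda>i. (step T ^^ i) (u, f)) ` {1..k}"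
    using perm_transpose.split_orbit[OF pt tree_rel[OF T ufD opp_dart[OF ufD]]] by metis
  have later: "(step T ^^ i) (u, f) = (step T ^^ (i + n)) d" for i
    using uf by (simp add: funpow_add)
  \<comment> \<open>From time \<open>n\<close> on, the tour of \<open>T\<close> first runs through
    all darts outside \<open>S\<close>. A crossing edge whose chip lies in \<open>S\<close> must
    have been cut before.\<close>
  have early: "first_visit T d h < n" if h: "h \<in> crossing S" "h \<notin> T" "?eta T h \<in> S" for h
  proof (rule ccontr)
    assume late: "\<not> first_visit T d h < n"
    have hE: "h \<in> E" using h by (simp add: crossing_def)
    obtain y where y: "(y, h) \<in> D" "y \<in> S" "opp h y \<notin> S" using crossing_dart[OF h(1)] .
    let ?x = "(opp h y, h)"
    have x: "?x \<in> D" using y opp_dart by blast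
    then have "rel ?F (opp f u, f) ?x"
      using forest_rel[OF T _ opp_dart[OF ufD] x] other[of "opp h y"] y(3) dart_V by auto
    then have "?x \<in> (\<lambda>i. (step T ^^ i) (u, f)) ` {1..k}" using k by blast
    then obtain i where i: "i \<le> k" "?x = (step T ^^ (i + n)) d"
      unfolding later by auto
    then have le: "first_visit T d h \<le> i + n" using first_visit_le[of "i + n" T d h] by (metis snd_conv)
    have "first_visit T d h \<noteq> n"
      using first_visit[OF T d hE] uf h(2) fT(1) by auto
    then have "first_visit T d h - n \<in> {1..k}" "first_visit T d h - n + n = first_visit T d h"
      using late le i(1) by auto
    then have "rel ?F (opp f u, f) ((step T ^^ first_visit T d h) d)"
      using k later by (metis (no_types, lifting) imageI mem_Collect_eq)
    then have "conn ?F (opp f u) (?eta T h)"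
      using rel_conn[OF FE opp_dart[OF ufD]] by (fastforce simp: eta_first_visit)
    then show False using nS h(3) by blast
  qed
  \<comment> \<open>Both tours coincide up to time \<open>n\<close>, so the edges first seen before
    are treated alike.\<close>
  have keep: "h \<notin> T' \<and> ?eta T' h = ?eta T h" if h: "h \<in> E" "h \<notin> T" "first_visit T d h < n" for h
  proof
    have sv: "snd ((step T ^^ first_visit T d h) d) = h" using first_visit[OF T d h(1)] .
    then show "h \<notin> T'" using agree[OF h(3)] h(2) by simp
    have "first_visit T' d h \<le> first_visit T d h"
      using sv same[of "first_visit T d h"] h(3) by (intro first_visit_le) simp
    moreover from this have "first_visit T d h \<le> first_visit T' d h"
      using first_visit[OF T' d h(1)] same[of "first_visit T' d h"] h(3) by (intro first_visit_le) simp
    ultimately show "?eta T' h = ?eta T h"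
      using same[of "first_visit T d h"] h(3) by (simp add: eta_first_visit)
  qed
  have eta_f: "?eta T' f = u"
  proof -
    have le: "first_visit T' d f \<le> n" using same[of n] uf by (intro first_visit_le) simp
    moreover have "\<not> first_visit T' d f < n"
      using first_visit[OF T' d fT(3)] same[of "first_visit T' d f"] agree[of "first_visit T' d f"] fT
      by auto
    ultimately have "first_visit T' d f = n" by simp
    then show ?thesis using same[of n] uf by (simp add: eta_first_visit)
  qed
  let ?C = "{h \<in> crossing S. h \<notin> T \<and> ?eta T h \<in> S}"
  have fin: "finite (E - X)" "finite S" "finite ?C" "finite (inside E S - X)" for X
    using finite_E finite_V S(1) finite_subset by (auto simp: crossing_def inside_def)
  have sums: "sum (bern X d) S = int (card {h \<in> E - X. ?eta X h \<in> S})" for X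
    unfolding bernardi_def by (rule sum_card_fibres[OF fin(1,2)])
  have "{h \<in> E - T. ?eta T h \<in> S} \<subseteq> (inside E S - T) \<union> ?C"
  proof
    fix h assume h: "h \<in> {h \<in> E - T. ?eta T h \<in> S}"
    then have "(?eta T h, h) \<in> D" using eta_dart[OF T d] by blast
    then show "h \<in> (inside E S - T) \<union> ?C"
      using h by (auto simp: inside_def crossing_def dart_iff incident_def)
  qed
  then have "card {h \<in> E - T. ?eta T h \<in> S} \<le> card ((inside E S - T) \<union> ?C)"
    by (rule card_mono[rotated]) (use fin in auto)
  also have "\<dots> \<le> card (inside E S - T) + card ?C" by (rule card_Un_le)
  finally have upper: "card {h \<in> E - T. ?eta T h \<in> S} \<le> card (inside E S - T) + card ?C" .
  have fcross: "f \<in> crossing S"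
    using S(2,3) ufD by (auto simp: crossing_def dart_iff incident_def other_def split: if_splits)
  have "(inside E S - T') \<union> insert f ?C \<subseteq> {h \<in> E - T'. ?eta T' h \<in> S}"
  proof
    fix h assume "h \<in> (inside E S - T') \<union> insert f ?C"
    then consider "h \<in> inside E S - T'" | "h = f" | "h \<in> ?C" by blast
    then show "h \<in> {h \<in> E - T'. ?eta T' h \<in> S}"
    proof cases
      case 1
      then have "(?eta T' h, h) \<in> D" using eta_dart[OF T' d] by (auto simp: inside_def)
      then show ?thesis using 1 by (auto simp: inside_def dart_iff incident_def)
    next
      case 2
      then show ?thesis using fT eta_f S(2) by simp
    next
      case 3
      then show ?thesis using early[of h] keep[of h] by (auto simp: crossing_def)
    qed
  qed
  then have "card ((inside E S - T') \<union> insert f ?C) \<le> card {h \<in> E - T'. ?eta T' h \<in> S}"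
    by (rule card_mono[rotated]) (use finite_E in auto)
  moreover have "card ((inside E S - T') \<union> insert f ?C) = card (inside E S - T') + Suc (card ?C)"
  proof -
    have "(inside E S - T') \<inter> insert f ?C = {}"
      using fcross by (auto simp: inside_def crossing_def)
    then show ?thesis using fin fT(1) by (subst card_Un_disjoint) auto
  qed
  \<comment> \<open>Only \<open>f\<close> joins \<open>S\<close> to its complement within
    \<open>T\<close>, so \<open>T\<close> attains the maximal number |S| - 1 of edges inside
    \<open>S\<close>.\<close>
  moreover have "card T \<le> card (inside T S) + card (inside T (V - S)) + 1"
  proof -
    have "T \<subseteq> inside T S \<union> inside T (V - S) \<union> {f}"
    proof
      fix h assume h: "h \<in> T"
      show "h \<in> inside T S \<union> inside T (V - S) \<union> {f}"
      proof (rule ccontr)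
        assume no: "h \<notin> inside T S \<union> inside T (V - S) \<union> {f}"
        then have "h \<in> crossing S" using h tree_E[OF T] ends_V[of h] by (auto simp: inside_def crossing_def)
        then obtain x where x: "(x, h) \<in> D" "x \<in> S" "opp h x \<notin> S" by (rule crossing_dart)
        have "conn ?F x (opp h x)" using conn_edge[OF FE _ x(1)] h no by blast
        moreover have "opp h x \<in> V" using opp_dart[OF x(1)] dart_V by blast
        ultimately show False using x(2,3) rtrancl_trans by (fastforce simp: S_def)
      qed
    qed
    then have "card T \<le> card (inside T S \<union> inside T (V - S) \<union> {f})"
      using finite_tree[OF T] by (intro card_mono) (auto simp: inside_def)
    also have "\<dots> \<le> card (inside T S \<union> inside T (V - S)) + 1"
      using card_Un_le[of "inside T S \<union> inside T (V - S)" "{f}"] by simp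
    also have "\<dots> \<le> card (inside T S) + card (inside T (V - S)) + 1"
      using card_Un_le[of "inside T S"] by simp
    finally show ?thesis .
  qed
  moreover have "card (inside T (V - S)) + 1 \<le> card (V - S)"
    using S uV by (intro card_inside_tree[OF T]) auto
  moreover have "card (inside T' S) + 1 \<le> card S"
    using S by (intro card_inside_tree[OF T']) auto
  moreover have "card V = card S + card (V - S)"
    using S fin(2) card_mono[OF finite_V S(1)] by (simp add: card_Diff_subset)
  moreover note card_inside_diff[OF tree_E[OF T], of S] card_inside_diff[OF tree_E[OF T'], of S]
    tree_card[OF T] upper
  ultimately have "card {h \<in> E - T. ?eta T h \<in> S} < card {h \<in> E - T'. ?eta T' h \<in> S}"
    by linarith
  then show False using sums[of T] sums[of T'] eq by simp
qed

lemma bern_inj: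
  assumes T: "tree T" and T': "tree T'" and d: "d \<in> D" and eq: "bern T d = bern T' d"
  shows "T = T'"
proof (rule ccontr)
  assume "T \<noteq> T'"
  then obtain h where h: "h \<in> E" "h \<in> T \<longleftrightarrow> h \<notin> T'" using tree_E[OF T] tree_E[OF T'] by blast
  let ?P = "\<lambda>n. snd ((step T ^^ n) d) \<in> T \<longleftrightarrow> snd ((step T ^^ n) d) \<notin> T'"
  define n where "n = (LEAST n. ?P n)"
  have "?P (first_visit T d h)" using first_visit[OF T d h(1)] h(2) by simp
  then have n: "?P n" unfolding n_def by (rule LeastI)
  have agree: "snd ((step T ^^ i) d) \<in> T \<longleftrightarrow> snd ((step T ^^ i) d) \<in> T'" if "i < n" for i
    using not_less_Least[of i ?P] that unfolding n_def by blast
  have same: "(step T' ^^ i) d = (step T ^^ i) d" if "i \<le> n" for i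
    using tour_cong[of i T d T'] agree that by simp
  show False
  proof (cases "snd ((step T ^^ n) d) \<in> T")
    case True
    then show ?thesis using bern_differs[OF T T' d agree, of n] n eq by blast
  next
    case False
    then show ?thesis
      using bern_differs[OF T' T d, of n] agree same n eq by (metis less_imp_le_nat order_refl)
  qed
qed

section \<open>Tree-independence of the difference between two starting darts\<close>

section \<open>Dependence on the starting point\<close>

text \<open>At \<open>w\<close> a chip counts positively for the dart arriving there and negatively
  for the dart leaving; both are indexed by the edge at \<open>w\<close>.\<close>

lemma chip_sum:
  "(\<Sum>d\<in>{d \<in> D. Q d}. chip d w) =
   (\<Sum>h\<in>{h. (w, h) \<in> D}. of_bool (Q (opp h w, h)) - of_bool (Q (w, h)))"
proof -
  let ?H = "{h. (w, h) \<in> D}"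
  have tail: "(\<Sum>d\<in>{d \<in> D. Q d}. of_bool (w = fst d) :: int) = (\<Sum>h\<in>?H. of_bool (Q (w, h)))"
  proof -
    have "(\<Sum>d\<in>{d \<in> D. Q d}. of_bool (w = fst d) :: int) = (\<Sum>d\<in>Pair w ` ?H. of_bool (Q d))"
      by (rule sum.mono_neutral_cong) (use finite_D in \<open>auto intro: finite_subset\<close>)
    also have "\<dots> = (\<Sum>h\<in>?H. of_bool (Q (w, h)))"
      by (subst sum.reindex) (auto simp: inj_on_def)
    finally show ?thesis .
  qed
  have head: "(\<Sum>d\<in>{d \<in> D. Q d}. of_bool (w = opp (snd d) (fst d)) :: int) =
      (\<Sum>h\<in>?H. of_bool (Q (opp h w, h)))"
  proof -
    have fin: "finite ((\<lambda>h. (opp h w, h)) ` ?H)"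
      by (rule finite_subset[OF _ finite_D]) (auto intro: opp_dart)
    have "(\<Sum>d\<in>{d \<in> D. Q d}. of_bool (w = opp (snd d) (fst d)) :: int) =
        (\<Sum>d\<in>(\<lambda>h. (opp h w, h)) ` ?H. of_bool (Q d))"
    proof (rule sum.mono_neutral_cong[OF fin])
      fix d assume d: "d \<in> {d \<in> D. Q d} - (\<lambda>h. (opp h w, h)) ` ?H"
      show "of_bool (w = opp (snd d) (fst d)) = (0 :: int)"
      proof (rule ccontr)
        assume "\<not> ?thesis"
        then have w: "w = opp (snd d) (fst d)" by (auto split: if_splits)
        have "(fst d, snd d) \<in> D" using d by simp
        then have "(w, snd d) \<in> D" "opp (snd d) w = fst d" using w opp_dart opp_opp by auto
        then have "d \<in> (\<lambda>h. (opp h w, h)) ` ?H" by (intro image_eqI[of _ _ "snd d"]) auto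
        then show False using d by blast
      qed
    qed (use finite_D in \<open>auto simp: opp_opp intro: opp_dart\<close>)
    also have "\<dots> = (\<Sum>h\<in>?H. of_bool (Q (opp h w, h)))"
      by (subst sum.reindex) (auto simp: inj_on_def)
    finally show ?thesis .
  qed
  show ?thesis unfolding chip_def sum_subtractf head tail ..
qed

lemma principal_cong: "principal A \<Longrightarrow> (\<And>w. A w = B w) \<Longrightarrow> principal B"
  by (simp add: principal_def)

lemma finite_edges_at: "finite {h. (w, h) \<in> D}"
  by (rule finite_subset[OF _ finite_E]) (auto intro: dart_E)

text \<open>Turning past \<open>e\<close> changes the class by that of \<open>chip (v, e)\<close>,
  whatever the tree. For \<open>e\<close> outside \<open>T\<close> this is \<open>bern_step\<close>.
  For \<open>e\<close> in \<open>T\<close> the tour runs around the component S beyond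
  \<open>e\<close> and moves a chip out of S along each non-tree edge leaving S; with one more chip
  leaving along \<open>e\<close>, this is the firing of S.\<close>

lemma bern_rot:
  assumes T: "tree T" and d: "(v, e) \<in> D"
  shows "principal (\<lambda>w. bern T (v, rot v e) w - bern T (v, e) w - chip (v, e) w)"
proof (cases "e \<in> T")
  case False
  then have "bern T (v, rot v e) w - bern T (v, e) w - chip (v, e) w = 0" for w
    using bern_step[OF T d, of w] by (simp add: step_simps tree_chip_def)
  then show ?thesis using principal_cong[OF principal_zero] by simp
next
  case True
  let ?F = "T - {e}" and ?v = "opp e v"
  have F: "?F \<subseteq> E" using tree_E[OF T] by blast
  have b: "(?v, e) \<in> D" using opp_dart d by blast
  define S where "S = {w \<in> V. conn ?F ?v w}"
  have bridge: "\<not> conn ?F v ?v" using tree_bridge[OF T True d] .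
  have S: "?v \<in> S" "v \<notin> S" using b dart_V bridge conn_sym by (auto simp: S_def)
  have pt: "perm_transpose D (step T) (step ?F) (v, e) (?v, e)"
    using perm_transpose_sym[OF perm_transpose_step[OF d, of ?F]] True by (simp add: insert_absorb)
  have X: "{x. rel ?F (?v, e) x} = {d \<in> D. fst d \<in> S}"
  proof (intro equalityI subsetI)
    fix x assume "x \<in> {x. rel ?F (?v, e) x}"
    then show "x \<in> {d \<in> D. fst d \<in> S}"
      using rel_in[OF b] rel_conn[OF F b] dart_V by (cases x) (force simp: S_def)
  next
    fix x assume "x \<in> {d \<in> D. fst d \<in> S}"
    then show "x \<in> {x. rel ?F (?v, e) x}"
      using forest_rel[OF T _ b, of ?F x] by (auto simp: S_def)
  qed
  have "bern T (v, rot v e) w - bern T (v, e) w - chip (v, e) w =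
      (if w \<in> V then laplacian E ends (\<lambda>x. - of_bool (x \<in> S)) w else 0)" for w
  proof -
    let ?H = "{h. (w, h) \<in> D}" and ?t = "\<lambda>h. of_bool (opp h w \<in> S) - of_bool (w \<in> S) :: int"
    have "step T (?v, e) = (v, rot v e)" using True opp_opp[OF d] by (simp add: step_simps)
    then have "bern T (v, rot v e) w = bern T (v, e) w + (\<Sum>d\<in>{d \<in> D. fst d \<in> S}. tree_chip T d w)"
      using bern_across[OF T pt, of w] True unfolding X by (simp add: tree_chip_def)
    also have "(\<Sum>d\<in>{d \<in> D. fst d \<in> S}. tree_chip T d w) =
        (\<Sum>d\<in>{d \<in> D. fst d \<in> S \<and> snd d \<notin> T}. chip d w)"
      by (rule sum.mono_neutral_cong_right) (use finite_D in \<open>auto simp: tree_chip_def\<close>)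
    also have "\<dots> = (\<Sum>h\<in>?H. if h \<in> T then 0 else ?t h)"
      unfolding chip_sum by (rule sum.cong) auto
    also have "\<dots> = (\<Sum>h\<in>?H. ?t h) - (\<Sum>h\<in>?H. if h \<in> T then ?t h else 0)"
      unfolding sum_subtractf[symmetric] by (rule sum.cong) auto
    \<comment> \<open>Of the tree edges only \<open>e\<close> joins \<open>S\<close> to its
      complement; the other terms vanish.\<close>
    also have "(\<Sum>h\<in>?H. if h \<in> T then ?t h else 0) = (\<Sum>h\<in>?H. if h = e then ?t h else 0)"
    proof (rule sum.cong[OF refl])
      fix h assume h: "h \<in> ?H"
      have "?t h = 0" if "h \<in> T" "h \<noteq> e"
      proof -
        have c: "conn ?F w (opp h w)" using conn_edge[OF F, of h w] that h by blast
        have "w \<in> V" "opp h w \<in> V" using h opp_dart dart_V by blast+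
        then show ?thesis
          using rtrancl_trans[OF _ c] rtrancl_trans[OF _ conn_sym[OF c]] by (auto simp: S_def)
      qed
      then show "(if h \<in> T then ?t h else 0) = (if h = e then ?t h else 0)" using True by simp
    qed
    also have "\<dots> = (if (w, e) \<in> D then ?t e else 0)"
      using finite_edges_at[of w] by (simp add: sum.delta)
    also have "\<dots> = - chip (v, e) w"
      using dart_cases[OF d, of w] S opp_opp[OF d] opp_neq[OF d] by (auto simp: chip_def)
    also have "(\<Sum>h\<in>?H. ?t h) = (if w \<in> V then laplacian E ends (\<lambda>x. - of_bool (x \<in> S)) w else 0)"
    proof (cases "w \<in> V")
      case True
      then show ?thesis unfolding laplacian_def edges_at_eq by (auto intro: sum.cong)
    next
      case False
      then have "?H = {}" using dart_V by blast
      then show ?thesis using False by simp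
    qed
    finally show ?thesis by simp
  qed
  then show ?thesis unfolding principal_def by blast
qed

text \<open>Comparing pairs of trees avoids naming the common class of the differences.\<close>

definition const_shift :: "'v \<times> 'e \<Rightarrow> 'v \<times> 'e \<Rightarrow> bool" where
  "const_shift d d' \<longleftrightarrow> (\<forall>T T'. tree T \<longrightarrow> tree T' \<longrightarrow>
     principal (\<lambda>w. (bern T d w - bern T d' w) - (bern T' d w - bern T' d' w)))"

lemma const_shift_refl: "const_shift d d"
  using principal_zero by (simp add: const_shift_def)

lemma const_shift_sym: "const_shift d d' \<Longrightarrow> const_shift d' d"
  unfolding const_shift_def
proof (intro allI impI)
  fix T T' assume all: "\<forall>T T'. tree T \<longrightarrow> tree T' \<longrightarrow>
      principal (\<lambda>w. (bern T d w - bern T d' w) - (bern T' d w - bern T' d' w))"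
    and T: "tree T" "tree T'"
  show "principal (\<lambda>w. (bern T d' w - bern T d w) - (bern T' d' w - bern T' d w))"
    by (rule principal_cong[OF principal_minus[OF all[rule_format, OF T]]]) simp
qed

lemma const_shift_trans:
  assumes "const_shift d d'" "const_shift d' d''"
  shows "const_shift d d''"
  unfolding const_shift_def
proof (intro allI impI)
  fix T T' assume T: "tree T" "tree T'"
  show "principal (\<lambda>w. (bern T d w - bern T d'' w) - (bern T' d w - bern T' d'' w))"
    by (rule principal_cong[OF principal_add[OF assms[unfolded const_shift_def, rule_format, OF T]]]) simp
qed

lemma const_shift_rot: "(v, e) \<in> D \<Longrightarrow> const_shift (v, e) (v, rot v e)"
proof (rule const_shift_sym, unfold const_shift_def, intro allI impI)
  fix T T' assume d: "(v, e) \<in> D" and T: "tree T" "tree T'"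
  show "principal (\<lambda>w. (bern T (v, rot v e) w - bern T (v, e) w) - (bern T' (v, rot v e) w - bern T' (v, e) w))"
    by (rule principal_cong[OF principal_diff[OF bern_rot[OF T(1) d] bern_rot[OF T(2) d]]]) simp
qed

lemma const_shift_vertex:
  assumes "(v, e) \<in> D" "(v, e') \<in> D"
  shows "const_shift (v, e) (v, e')"
proof -
  have "const_shift (v, e) (v, (rot v ^^ n) e)" for n
  proof (induction n)
    case (Suc n)
    then show ?case using const_shift_trans[OF _ const_shift_rot[OF rot_funpow_in[OF assms(1)]]] by simp
  qed (simp add: const_shift_refl)
  then show ?thesis using rot_transitive[OF assms] by blast
qed

text \<open>Compare the starts just before and just after walking \<open>e\<close>. For a tree
  through \<open>e\<close> no chip moves between them; so for \<open>T\<close> the two Bernardi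
  divisors are equivalent break divisors, hence equal. By \<open>bern_across\<close> the chips moved
  from one side of \<open>e\<close> to the other then cancel at each vertex.\<close>

lemma const_shift_balanced:
  assumes all: "\<And>d d'. d \<in> D \<Longrightarrow> d' \<in> D \<Longrightarrow> const_shift d d'"
  shows balanced
  unfolding balanced_def
proof (intro allI impI)
  fix T v e w assume T: "tree T" and b: "(v, e) \<in> D" and e: "e \<notin> T"
  let ?v = "opp e v"
  let ?a = "(?v, e)" and ?b = "(v, e)" and ?d = "(v, rot v e)"
  have a: "?a \<in> D" using b opp_dart by blast
  have vv: "opp e ?v = v" using opp_opp[OF b] .
  have dD: "?d \<in> D" using rot_in b by blast
  have V: "v \<in> V" "?v \<in> V" using a b dart_V by blast+
  obtain h where h: "h \<in> T" "\<not> conn (T - {h}) v ?v"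
    using separating_tree_edge[OF T V] opp_neq[OF b] by metis
  define T' where "T' = insert e (T - {h})"
  have T': "tree T'" "e \<in> T'" using tree_exchange[OF T h(1) b e h(2)] by (auto simp: T'_def)
  have "bern T' ?d w = bern T' ?a w" for w
    using bern_step[OF T'(1) a, of w] T'(2) vv by (simp add: step_simps tree_chip_def)
  then have "principal (\<lambda>w. bern T ?d w - bern T ?a w)"
    using all[OF dD a, unfolded const_shift_def, rule_format, OF T T'(1)] by simp
  then have eq: "bern T ?d = bern T ?a"
    using break_unique bern_break[OF T dD] bern_break[OF T a] by blast
  let ?R = "rel (insert e T)"
  have pt: "perm_transpose D (step T) (step (insert e T)) ?a ?b"
    using perm_transpose_step[OF a e] vv by simp
  have X: "{x. ?R ?b x} = insert ?b {d \<in> D. ?R ?b d \<and> snd d \<noteq> e}"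
  proof (intro equalityI subsetI)
    fix x assume x: "x \<in> {x. ?R ?b x}"
    then have xD: "x \<in> D" using rel_in[OF b] by blast
    have "x \<noteq> ?a" using x rel_split_separated[OF T b e] by blast
    then have "x = ?b \<or> snd x \<noteq> e" using xD dart_cases[OF b, of "fst x"] by (cases x) auto
    then show "x \<in> insert ?b {d \<in> D. ?R ?b d \<and> snd d \<noteq> e}" using x xD by blast
  qed auto
  have "step T ?b = ?d" using e by (simp add: step_simps)
  then have "0 = tree_chip T ?a w + (\<Sum>d\<in>{x. ?R ?b x}. tree_chip T d w)"
    using bern_across[OF T pt, of w] eq by simp
  also have "(\<Sum>d\<in>{x. ?R ?b x}. tree_chip T d w) =
      tree_chip T ?b w + (\<Sum>d\<in>{d \<in> D. ?R ?b d \<and> snd d \<noteq> e}. tree_chip T d w)"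
    unfolding X using finite_D by simp
  also have "(\<Sum>d\<in>{d \<in> D. ?R ?b d \<and> snd d \<noteq> e}. tree_chip T d w) =
      (\<Sum>d\<in>{d \<in> D. ?R ?b d \<and> snd d \<notin> insert e T}. chip d w)"
    by (rule sum.mono_neutral_cong_right) (use finite_D in \<open>auto simp: tree_chip_def\<close>)
  also have "tree_chip T ?a w + (tree_chip T ?b w + \<dots>) = \<dots>"
    using e vv by (simp add: tree_chip_def chip_def)
  also have "\<dots> = (\<Sum>h\<in>{h. (w, h) \<in> D}. of_bool (?R ?b (opp h w, h) \<and> h \<notin> insert e T)) -
      (\<Sum>h\<in>{h. (w, h) \<in> D}. of_bool (?R ?b (w, h) \<and> h \<notin> insert e T))"
    unfolding chip_sum sum_subtractf by simp
  finally have cards: "card {h \<in> {h. (w, h) \<in> D}. ?R ?b (opp h w, h) \<and> h \<notin> insert e T} =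
      card {h \<in> {h. (w, h) \<in> D}. ?R ?b (w, h) \<and> h \<notin> insert e T}"
    by (simp only: card_filter_sum[OF finite_edges_at, symmetric])
  let ?RH = "{h \<in> {h. (w, h) \<in> D}. ?R ?b (opp h w, h) \<and> h \<notin> insert e T}"
  let ?LH = "{h \<in> {h. (w, h) \<in> D}. ?R ?b (w, h) \<and> h \<notin> insert e T}"
  have fin: "finite ?RH" "finite ?LH" using finite_edges_at by auto
  \<comment> \<open>The sets are finite of equal size, so one has an element outside the other
    exactly if the converse holds.\<close>
  have "?LH \<subseteq> ?RH \<longleftrightarrow> ?RH \<subseteq> ?LH"
    using card_subset_eq[OF fin(1), of ?LH] card_subset_eq[OF fin(2), of ?RH] cards by auto
  then show "(\<exists>h. (w, h) \<in> D \<and> h \<notin> insert e T \<and> ?R ?b (w, h) \<and> \<not> ?R ?b (opp h w, h)) \<longleftrightarrow>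
      (\<exists>h. (w, h) \<in> D \<and> h \<notin> insert e T \<and> \<not> ?R ?b (w, h) \<and> ?R ?b (opp h w, h))"
    by blast
qed

section \<open>From equal actions to tree-independent differences\<close>

section \<open>Equal actions\<close>

text \<open>The same choice of an edge as in \<open>tree_act\<close>.\<close>

definition start :: "'v \<Rightarrow> 'v \<times> 'e" where
  "start v = (v, SOME e. e \<in> edges_at E ends v)"

lemma start_in:
  assumes v: "v \<in> V"
  shows "start v \<in> D"
proof -
  obtain e where e: "e \<in> E" using E_nonempty by blast
  obtain w where w: "w \<in> V" "w \<noteq> v" using ends_V[OF e] by metis
  have "conn E v w" using connected v w by (auto simp: connected_on_def)
  then obtain f x where "(x, f) \<in> D" "x \<in> {v}"
    using conn_leaves[OF subset_refl, of v "{v}" w] w by blast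
  then have "(SOME e. e \<in> edges_at E ends v) \<in> edges_at E ends v"
    by (intro someI[where P="\<lambda>e. e \<in> edges_at E ends v" and x=f]) (simp add: edges_at_eq)
  then show ?thesis by (simp add: start_def edges_at_eq)
qed

lemma tree_act_eq: "tree_act V E ends rot v \<gamma> T =
   inv_into (spanning_trees V E ends) (\<lambda>T. bern T (start v))
     (break_rep V E ends (\<lambda>w. bern T (start v) w + \<gamma> w))"
  by (simp add: tree_act_def start_def Let_def pic_act_break_def)

lemma break_rep_eq:
  assumes "B \<in> break_divs V E ends" "principal (\<lambda>w. B w - A w)"
  shows "break_rep V E ends A = B"
  unfolding break_rep_def lin_equiv_iff
proof (rule the_equality)
  fix B' assume B': "B' \<in> break_divs V E ends \<and> principal (\<lambda>w. B' w - A w)"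
  then have "principal (\<lambda>w. B' w - B w)"
    using principal_cong[OF principal_diff[OF _ assms(2)], of "\<lambda>w. B' w - A w"] by simp
  then show "B' = B" using break_unique B' assms(1) by blast
qed (use assms in blast)

text \<open>Break representatives are unique and the Bernardi map is injective, so an explicit
  solution determines the values of both \<open>THE\<close> and \<open>inv_into\<close>.\<close>

lemma tree_act_principal:
  assumes v: "v \<in> V" and T: "tree T" "tree T'"
    and p: "principal (\<lambda>w. bern T' (start v) w - (bern T (start v) w + \<gamma> w))"
  shows "tree_act V E ends rot v \<gamma> T = T'"
proof -
  have "break_rep V E ends (\<lambda>w. bern T (start v) w + \<gamma> w) = bern T' (start v)"
    using break_rep_eq[OF bern_break[OF T(2) start_in[OF v]] p] .
  moreover have "inj_on (\<lambda>T. bern T (start v)) (spanning_trees V E ends)"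
    using bern_inj start_in[OF v] by (auto simp: inj_on_def spanning_trees_def)
  ultimately show ?thesis
    unfolding tree_act_eq using T(2) by (simp add: inv_into_f_f spanning_trees_def)
qed

text \<open>Without surjectivity of the Bernardi map or existence of break representatives,
  \<open>inv_into\<close> and \<open>THE\<close> might return junk, but each of them only one fixed value; so the
  action can be inverted away from two trees.\<close>

lemma principal_if_tree_act:
  assumes v: "v \<in> V"
  obtains c c' where "\<And>T T' \<gamma>. tree T \<Longrightarrow> tree T' \<Longrightarrow> T' \<noteq> c \<Longrightarrow> T' \<noteq> c' \<Longrightarrow>
    tree_act V E ends rot v \<gamma> T = T' \<Longrightarrow> principal (\<lambda>w. bern T' (start v) w - (bern T (start v) w + \<gamma> w))"
proof -
  let ?S = "spanning_trees V E ends" and ?b = "\<lambda>T. bern T (start v)"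
  \<comment> \<open>\<open>c\<close> is the value of \<open>inv_into\<close> outside the image of
    the Bernardi map; \<open>c'\<close> is its value at the junk divisor that \<open>THE\<close>
    yields when no representative exists.\<close>
  define c where "c = (SOME T :: 'e set. False)"
  define c' where "c' = inv_into ?S ?b (THE B. False)"
  show thesis
  proof (rule that[of c c'])
    fix T T' \<gamma> assume T: "tree T" "tree T'" and ne: "T' \<noteq> c" "T' \<noteq> c'"
      and act: "tree_act V E ends rot v \<gamma> T = T'"
    let ?A = "\<lambda>w. bern T (start v) w + \<gamma> w"
    have ex: "\<exists>B. B \<in> break_divs V E ends \<and> principal (\<lambda>w. B w - ?A w)"
    proof (rule ccontr)
      assume "\<not> ?thesis"
      then have "break_rep V E ends ?A = (THE B. False)"
        unfolding break_rep_def lin_equiv_iff by (intro arg_cong[where f=The] ext) blast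
      then show False using act ne(2) by (simp add: tree_act_eq c'_def)
    qed
    then obtain B where B: "B \<in> break_divs V E ends" "principal (\<lambda>w. B w - ?A w)" by blast
    have inv: "inv_into ?S ?b B = T'" using act break_rep_eq[OF B] by (simp add: tree_act_eq)
    have "B \<in> ?b ` ?S"
    proof (rule ccontr)
      assume "B \<notin> ?b ` ?S"
      then have "inv_into ?S ?b B = c"
        unfolding inv_into_def c_def by (intro arg_cong[where f=Eps] ext) blast
      then show False using inv ne(1) by simp
    qed
    then have "?b T' = B" using f_inv_into_f[of B ?b ?S] inv by simp
    then show "principal (\<lambda>w. bern T' (start v) w - ?A w)" using B(2) by simp
  qed
qed

text \<open>Here \<open>c\<close> and \<open>c'\<close> stand for the exceptional values of
  \<open>principal_if_tree_act\<close>. The tree \<open>T\<close> and two exchanges of it, one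
  bringing in \<open>e\<close> and one \<open>f\<close>, are three different trees.\<close>

lemma interlaced_three_trees:
  assumes T: "tree T" and ef: "interlaced T e f"
  obtains T' where "tree T'" "T' \<noteq> c" "T' \<noteq> c'"
proof -
  have ex: "\<exists>T'. tree T' \<and> k \<in> T' \<and> T' \<subseteq> insert k T" if k: "k \<in> E" "k \<notin> T" for k
  proof -
    obtain v where v: "(v, k) \<in> D" using k edge_dart by blast
    have V: "v \<in> V" "opp k v \<in> V" using v opp_dart dart_V by blast+
    obtain h where h: "h \<in> T" "\<not> conn (T - {h}) v (opp k v)"
      using separating_tree_edge[OF T V] opp_neq[OF v] by metis
    then show ?thesis using tree_exchange[OF T h(1) v k(2) h(2)] by blast
  qed
  have m: "e \<in> E" "e \<notin> T" "f \<in> E" "f \<notin> T" "e \<noteq> f" using ef by (auto simp: interlaced_def)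
  obtain T1 where T1: "tree T1" "e \<in> T1" "T1 \<subseteq> insert e T" using ex m by blast
  obtain T2 where T2: "tree T2" "f \<in> T2" "T2 \<subseteq> insert f T" using ex m by blast
  have "T1 \<noteq> T" "T2 \<noteq> T" "T1 \<noteq> T2" using T1 T2 m by blast+
  then show thesis using that[OF T] that[OF T1(1)] that[OF T2(1)] by metis
qed

lemma const_shift_start:
  assumes v: "v \<in> V" "v' \<in> V" and T0: "tree T0" "interlaced T0 e f"
    and act: "\<And>\<gamma> T. \<gamma> \<in> div0 V \<Longrightarrow> tree T \<Longrightarrow>
      tree_act V E ends rot v \<gamma> T = tree_act V E ends rot v' \<gamma> T"
  shows "const_shift (start v) (start v')"
proof -
  obtain c c' where cc: "\<And>T T' \<gamma>. tree T \<Longrightarrow> tree T' \<Longrightarrow> T' \<noteq> c \<Longrightarrow> T' \<noteq> c' \<Longrightarrow>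
    tree_act V E ends rot v' \<gamma> T = T' \<Longrightarrow> principal (\<lambda>w. bern T' (start v') w - (bern T (start v') w + \<gamma> w))"
    using principal_if_tree_act[OF v(2)] by blast
  obtain T1 where T1: "tree T1" "T1 \<noteq> c" "T1 \<noteq> c'" using interlaced_three_trees[OF T0] .
  have key: "principal (\<lambda>w. (bern T (start v) w - bern T (start v') w) - (bern T1 (start v) w - bern T1 (start v') w))"
    if T: "tree T" for T
  proof -
    \<comment> \<open>This class takes \<open>T\<close> to the reference tree \<open>T1\<close>
      under the action at \<open>v\<close>, hence also at \<open>v'\<close>; expressing it at
      \<open>v'\<close> as well compares the differences for \<open>T\<close> and
      \<open>T1\<close>.\<close>
    define \<gamma> where "\<gamma> = (\<lambda>w. bern T1 (start v) w - bern T (start v) w)"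
    note br = bern_break[OF T1(1) start_in[OF v(1)]] bern_break[OF T start_in[OF v(1)]]
    have "\<gamma> \<in> div0 V"
      using br[THEN break_outside] br[THEN break_total] by (simp add: div0_def \<gamma>_def sum_subtractf)
    moreover have "tree_act V E ends rot v \<gamma> T = T1"
      by (rule tree_act_principal[OF v(1) T T1(1)]) (simp add: \<gamma>_def principal_zero)
    ultimately have "tree_act V E ends rot v' \<gamma> T = T1" using act T by metis
    then have "principal (\<lambda>w. bern T1 (start v') w - (bern T (start v') w + \<gamma> w))"
      using cc[OF T T1] by blast
    then show ?thesis by (rule principal_cong) (simp add: \<gamma>_def)
  qed
  show ?thesis
    unfolding const_shift_def
  proof (intro allI impI)
    fix T T' assume T: "tree T" "tree T'"
    show "principal (\<lambda>w. (bern T (start v) w - bern T (start v') w) - (bern T' (start v) w - bern T' (start v') w))"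
      by (rule principal_cong[OF principal_diff[OF key[OF T(1)] key[OF T(2)]]]) simp
  qed
qed

lemma actions_differ:
  assumes np: "\<not> planar_ribbon V E ends rot"
  shows "\<exists>v\<in>V. \<exists>v'\<in>V. \<exists>\<gamma>\<in>div0 V. \<exists>T\<in>spanning_trees V E ends.
    tree_act V E ends rot v \<gamma> T \<noteq> tree_act V E ends rot v' \<gamma> T"
proof (rule ccontr)
  assume no: "\<not> ?thesis"
  obtain T where T: "tree T" using ex_tree by blast
  obtain e f where ef: "interlaced T e f" using ex_interlaced[OF T np] .
  have starts: "const_shift (start v) (start v')" if "v \<in> V" "v' \<in> V" for v v'
    using const_shift_start[OF that T ef] no that unfolding spanning_trees_def by blast
  have "const_shift d d'" if d: "d \<in> D" "d' \<in> D" for d d'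
  proof -
    have V: "fst d \<in> V" "fst d' \<in> V" using d dart_V by (metis prod.collapse)+
    \<comment> \<open>Rotation links each dart to the starting dart at its own vertex, and equal
      actions link the starting darts of different vertices.\<close>
    have to_start: "const_shift x (start (fst x))" if "x \<in> D" for x
      using const_shift_vertex[of "fst x" "snd x" "snd (start (fst x))"] that start_in[of "fst x"]
        dart_V[of "fst x" "snd x"] by (simp add: start_def)
    show ?thesis
      using const_shift_trans[OF to_start[OF d(1)]
          const_shift_trans[OF starts[OF V] const_shift_sym[OF to_start[OF d(2)]]]] .
  qed
  then show False using not_balanced[OF T ef] const_shift_balanced by blast
qed

end

theorem theorem5p2:
  fixes V :: "'v set" and E :: "'e set" and ends :: "'e \<Rightarrow> 'v \<times> 'v"
    and rot :: "'v \<Rightarrow> 'e \<Rightarrow> 'e"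
  assumes "ribbon_graph V E ends rot"
    and "\<not> planar_ribbon V E ends rot"
  shows "\<exists>v\<in>V. \<exists>v'\<in>V. \<exists>\<gamma>\<in>div0 V. \<exists>T\<in>spanning_trees V E ends.
           tree_act V E ends rot v \<gamma> T \<noteq> tree_act V E ends rot v' \<gamma> T"
proof -
  interpret ribbon V E ends rot
    using assms by unfold_locales (auto simp: planar_ribbon_def)
  show ?thesis using actions_differ[OF assms(2)] .
qed

end
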